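(* Let $f$ be an inner function with $f(0)=0$ which is not a rotation and let $\{a_{n}\}_{n\ge1}$ be a sequence of complex numbers not identically zero. Then $\sum_{n=1}^{\infty} a_{n}f^{n}\in A(\mathbb{D})$ if and only if $f$ is a finite Blaschke product and $\sum_{n=1}^{\infty} |a_{n}|<\infty$.
   Context: $\mathbb{D}$ is the open unit disc and $\partial\mathbb{D}$ the unit circle. An inner function is an analytic mapping $f:\mathbb{D}\to\mathbb{D}$ whose radial limits have modulus one at almost every point of $\partial\mathbb{D}$. A rotation is a map $z\mapsto \lambda z$ with $|\lambda|=1$. $f^{n}$ denotes the $n$-th iterate of $f$ (not the power). $A(\mathbb{D})$ is the disc algebra: the space of analytic functions in $\mathbb{D}$ which extend continuously to $\overline{\mathbb{D}}=\{z\in\mathbb{C}:|z|\le1\}$. The condition $\sum a_nf^n\in A(\mathbb{D})$ means that the series converges uniformly on compact subsets of $\mathbb{D}$ and its sum belongs to $A(\mathbb{D})$. *)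

theory Defs
  imports "HOL-Complex_Analysis.Complex_Analysis"
begin

text \<open>
  Functions on the open unit disc are represented by total functions on the complex plane;
  every notion below depends only on their values on \<^term>\<open>ball (0::complex) 1\<close>.
\<close>

text \<open>Arc-length null sets of the unit circle are the null sets of the angle \<^term>\<open>t\<close>.\<close>

definition inner_function :: "(complex \<Rightarrow> complex) \<Rightarrow> bool" where
  "inner_function f \<longleftrightarrow>
     f holomorphic_on ball 0 1 \<and> f ` ball 0 1 \<subseteq> ball 0 1 \<and>
     (AE t in lborel. t \<in> {0..2 * pi} \<longrightarrow>
        (\<exists>l. ((\<lambda>r. f (complex_of_real r * cis t)) \<longlongrightarrow> l) (at_left 1) \<and> norm l = 1))"

definition rotation :: "(complex \<Rightarrow> complex) \<Rightarrow> bool" where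
  "rotation f \<longleftrightarrow> (\<exists>c. norm c = 1 \<and> (\<forall>z\<in>ball 0 1. f z = c * z))"

text \<open>
  The zeros \<^term>\<open>\<alpha> k\<close> may repeat. The degree \<^term>\<open>N\<close> may be 0, which gives the
  unimodular constants; these are not inner functions in the sense above.
\<close>

definition finite_Blaschke_product :: "(complex \<Rightarrow> complex) \<Rightarrow> bool" where
  "finite_Blaschke_product f \<longleftrightarrow>
     (\<exists>(c::complex) (N::nat) (\<alpha>::nat \<Rightarrow> complex). norm c = 1 \<and> (\<forall>k<N. norm (\<alpha> k) < 1) \<and>
        (\<forall>z\<in>ball 0 1. f z = c * (\<Prod>k<N. (z - \<alpha> k) / (1 - cnj (\<alpha> k) * z))))"

definition disc_algebra :: "(complex \<Rightarrow> complex) set" where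
  "disc_algebra = {g. g holomorphic_on ball 0 1 \<and>
     (\<exists>h. continuous_on (cball 0 1) h \<and> (\<forall>z\<in>ball 0 1. h z = g z))}"

text \<open>
  The series \<open>u 1 + u 2 + \<dots>\<close> of functions on the disc; the value \<^term>\<open>u 0\<close> is ignored.
\<close>

definition series_in_disc_algebra :: "(nat \<Rightarrow> complex \<Rightarrow> complex) \<Rightarrow> bool" where
  "series_in_disc_algebra u \<longleftrightarrow>
     (\<exists>g\<in>disc_algebra. \<forall>K. compact K \<and> K \<subseteq> ball 0 1 \<longrightarrow>
        uniform_limit K (\<lambda>N z. \<Sum>n=1..N. u n z) g sequentially)"

end

theory Submission
  imports Defs
begin

text \<open>
  If $f$ is inner with $f(0) = 0$, the images $f(\{|z| \le r\})$ with their holes filled in exhaust the disc as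
  $r \to 1$. Hence a locally uniformly convergent series $\sum a_n f^n$ equals $H \circ f$ with $H = \sum a_n f^{n-1}$
  holomorphic in the disc, and it vanishes only if all $a_n$ do: otherwise the leading term would provide
  a left inverse $k$ of $f$ mapping the disc into itself, and the Schwarz lemma would make $f$ a rotation.
  If $f$ is not a finite Blaschke product and the sum is continuous up to the boundary, then $H$ is
  constant on a cluster set of $f$ with limit points in the disc, so the sum is zero.

  If $f$ is a finite Blaschke product and $\lambda = f'(0)$, then $D = z - \overline\lambda f$ satisfies
  $\int D \cdot (h \circ f) = 0$ on the circle for all continuous $h$, so the $D \circ f^n$ are reverse martingale
  differences. Rewriting the sum as $\sum b_n D \circ f^n$ with $a_n = b_n - \overline\lambda b_{n-1}$ and integrating it
  against Riesz products $\prod (1 + \frac12 \mathrm{Re}(c_n D \circ f^n)) \ge 0$ bounds $\sum |b_n|$ by a multiple of the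
  supremum of the sum.
\<close>

section \<open>Blaschke factors and unimodular radial limits\<close>

text \<open>The main use of the radial limits is one principle: a holomorphic function bounded by 1,
  bounded away from 0 and with unimodular radial limits almost everywhere has modulus 1 at 0,
  because the logarithm of its modulus has the mean value property. It serves twice, to show that
  the filled images exhaust the disc and to end the splitting off of Blaschke factors. In the second
  half the Riesz products have mean 1 besides being nonnegative, so testing against them costs no
  more than the supremum; the factor 1/2 is due to |D| <= 2. Given f, the conditional mean of |D|^2
  is the constant 1 - |\<lambda>|^2, positive unless f is a rotation; this is the gain from each
  term. The obstacle is that the conditional mean of D^2 is cnj(\<tau>) f, with \<tau> the second
  Taylor coefficient of f, and need not vanish. The resulting cross terms decay geometrically in the
  gap between the selected indices, with ratio |\<lambda>|, so the indices are thinned out to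
  residue classes until the gain dominates. The number of classes depends only on f.\<close>

definition blaschke_factor :: "complex \<Rightarrow> complex \<Rightarrow> complex" where
  "blaschke_factor a z = (z - a) / (1 - cnj a * z)"

lemma Re_one_minus_pos:
  fixes a z :: complex
  assumes "norm a < 1" "norm z \<le> 1"
  shows "Re (1 - cnj a * z) > 0"
proof -
  have "norm (cnj a * z) \<le> norm a * 1"
    unfolding norm_mult complex_mod_cnj using assms by (intro mult_left_mono) auto
  with assms show ?thesis using complex_Re_le_cmod[of "cnj a * z"] by simp
qed

lemma one_minus_nonzero:
  fixes a z :: complex
  shows "norm a < 1 \<Longrightarrow> norm z \<le> 1 \<Longrightarrow> 1 - cnj a * z \<noteq> 0"
  using Re_one_minus_pos[of a z] by force

lemma one_minus_norm_blaschke_factor: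
  assumes "norm a < 1" "norm z \<le> 1"
  shows "1 - (norm (blaschke_factor a z))\<^sup>2 = (1 - (norm a)\<^sup>2) * (1 - (norm z)\<^sup>2) / (norm (1 - cnj a * z))\<^sup>2"
proof -
  have "(norm (1 - cnj a * z))\<^sup>2 - (norm (z - a))\<^sup>2 = (1 - (norm a)\<^sup>2) * (1 - (norm z)\<^sup>2)"
    unfolding cmod_power2 by (simp add: power2_eq_square algebra_simps)
  then show ?thesis
    using one_minus_nonzero[OF assms]
    by (simp add: blaschke_factor_def norm_divide power_divide diff_divide_eq_iff)
qed

lemma norm_blaschke_factor_le_1:
  assumes "norm a < 1" "norm z \<le> 1"
  shows "norm (blaschke_factor a z) \<le> 1"
proof -
  have "1 - (norm (blaschke_factor a z))\<^sup>2 \<ge> 0"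
    unfolding one_minus_norm_blaschke_factor[OF assms] using assms
    by (intro divide_nonneg_nonneg mult_nonneg_nonneg) (auto simp: power_le_one)
  then show ?thesis by (simp add: abs_square_le_1)
qed

lemma norm_blaschke_factor_less_1:
  assumes "norm a < 1" "norm z < 1"
  shows "norm (blaschke_factor a z) < 1"
proof -
  have "1 - (norm (blaschke_factor a z))\<^sup>2 > 0"
    using assms one_minus_nonzero[of a z]
    by (subst one_minus_norm_blaschke_factor) (auto intro!: divide_pos_pos mult_pos_pos simp: abs_square_less_1)
  then show ?thesis by (simp add: abs_square_less_1)
qed

lemma norm_blaschke_factor_eq_1:
  assumes "norm a < 1" "norm z = 1"
  shows "norm (blaschke_factor a z) = 1"
  using one_minus_norm_blaschke_factor[of a z] assms norm_ge_zero[of "blaschke_factor a z"]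
  by (auto simp add: power2_eq_1_iff simp del: norm_ge_zero)

lemma blaschke_factor_holomorphic: "norm a < 1 \<Longrightarrow> blaschke_factor a holomorphic_on ball 0 1"
  unfolding blaschke_factor_def[abs_def] using one_minus_nonzero[of a]
  by (intro holomorphic_intros) auto

lemma blaschke_factor_continuous: "norm a < 1 \<Longrightarrow> continuous_on (cball 0 1) (blaschke_factor a)"
  unfolding blaschke_factor_def[abs_def] using one_minus_nonzero[of a]
  by (intro continuous_intros) auto

text \<open>The defect 1 - |w|^2 grows under the Blaschke factor by at most a constant, since |1 -
  cnj a w| >= 1 - |a| on the closed disc. So unimodular limits survive although \<open>g\<close>
  itself need not converge.\<close>

lemma tendsto_norm_blaschke_factor:
  assumes a: "norm a < 1" and le: "\<forall>\<^sub>F x in F. norm (g x) \<le> 1" and lim: "((\<lambda>x. norm (g x)) \<longlongrightarrow> 1) F"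
  shows "((\<lambda>x. norm (blaschke_factor a (g x))) \<longlongrightarrow> 1) F"
proof -
  define C where "C = (1 - (norm a)\<^sup>2) / (1 - norm a)\<^sup>2"
  have *: "norm (1 - (norm (blaschke_factor a (g x)))\<^sup>2) \<le> C * (1 - (norm (g x))\<^sup>2)" if g: "norm (g x) \<le> 1" for x
  proof -
    have "norm (cnj a * g x) \<le> norm a * 1"
      unfolding norm_mult complex_mod_cnj using g by (intro mult_left_mono) auto
    then have "1 - norm a \<le> norm (1 - cnj a * g x)"
      using norm_triangle_ineq2[of 1 "cnj a * g x"] by simp
    then have "(1 - norm a)\<^sup>2 \<le> (norm (1 - cnj a * g x))\<^sup>2"
      using a by (intro power_mono) auto
    moreover have "0 \<le> (1 - (norm a)\<^sup>2) * (1 - (norm (g x))\<^sup>2)"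
      using a g by (intro mult_nonneg_nonneg) (auto simp: power_le_one)
    moreover have "(1 - norm a)\<^sup>2 > 0" using a by simp
    ultimately have le: "(1 - (norm a)\<^sup>2) * (1 - (norm (g x))\<^sup>2) / (norm (1 - cnj a * g x))\<^sup>2
        \<le> (1 - (norm a)\<^sup>2) * (1 - (norm (g x))\<^sup>2) / (1 - norm a)\<^sup>2"
      by (intro divide_left_mono mult_pos_pos) auto
    have "norm (1 - (norm (blaschke_factor a (g x)))\<^sup>2) = 1 - (norm (blaschke_factor a (g x)))\<^sup>2"
      using norm_blaschke_factor_le_1[OF a g] by (simp add: power_le_one)
    also have "\<dots> \<le> (1 - (norm a)\<^sup>2) * (1 - (norm (g x))\<^sup>2) / (1 - norm a)\<^sup>2"
      unfolding one_minus_norm_blaschke_factor[OF a g] by (rule le)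
    finally show ?thesis by (simp add: C_def)
  qed
  have "((\<lambda>x. (norm (g x))\<^sup>2) \<longlongrightarrow> 1\<^sup>2) F"
    using lim by (rule tendsto_power)
  then have "((\<lambda>x. C * (1 - (norm (g x))\<^sup>2)) \<longlongrightarrow> C * (1 - 1\<^sup>2)) F"
    by (rule tendsto_mult_left[OF tendsto_diff[OF tendsto_const]])
  then have "((\<lambda>x. 1 - (norm (blaschke_factor a (g x)))\<^sup>2) \<longlongrightarrow> 0) F"
    by (intro Lim_null_comparison[OF eventually_mono[OF le *]]) simp_all
  from tendsto_diff[OF tendsto_const this, of 1]
  have "((\<lambda>x. sqrt ((norm (blaschke_factor a (g x)))\<^sup>2)) \<longlongrightarrow> sqrt 1) F"
    by (intro tendsto_real_sqrt) simp
  then show ?thesis by simp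
qed

section \<open>Mean values over circles, zero-free functions and the Schwarz lemma\<close>

lemma has_integral_circle_mean:
  fixes h :: "complex \<Rightarrow> complex"
  assumes "0 < r" "continuous_on (cball 0 r) h" "h holomorphic_on ball 0 r"
  shows "((\<lambda>t. h (of_real r * cis t)) has_integral (2 * pi * h 0)) {0..2*pi}"
proof -
  have "((\<lambda>u. h u / (u - 0)) has_contour_integral (2 * of_real pi * \<i> * h 0)) (circlepath 0 r)"
    using assms by (intro Cauchy_integral_circlepath) auto
  then have "((\<lambda>t. h (0 + of_real r * cis t) / (0 + of_real r * cis t - 0) * of_real r * \<i> * cis t)
      has_integral (2 * of_real pi * \<i> * h 0)) {0..2*pi}"
    unfolding circlepath_def by (subst (asm) has_contour_integral_part_circlepath_iff) auto
  then have "((\<lambda>t. \<i> * h (of_real r * cis t)) has_integral (2 * of_real pi * \<i> * h 0)) {0..2*pi}"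
    by (rule has_integral_eq[rotated]) (use assms in \<open>auto simp: field_simps\<close>)
  then have "((\<lambda>t. -\<i> * (\<i> * h (of_real r * cis t))) has_integral (-\<i> * (2 * of_real pi * \<i> * h 0))) {0..2*pi}"
    by (rule has_integral_mult_right)
  moreover have "-\<i> * (2 * of_real pi * \<i> * h 0) = 2 * pi * h 0" "-\<i> * (\<i> * w) = w" for w
    by (simp_all add: complex_eq_iff)
  ultimately show ?thesis by (simp only:)
qed

text \<open>ln |g| is the real part of a holomorphic logarithm, so its means over circles of radius
  below 1 all equal ln |g(0)|; by dominated convergence they tend to 0. The bound \<delta> supplies
  the dominating function, and it excludes zero-free singular inner functions such as exp((z + 1) /
  (z - 1)), whose radial limits are unimodular as well.\<close>

lemma unimodular_at_0:
  assumes g: "g holomorphic_on ball 0 1" and "0 < \<delta>"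
    and lo: "\<And>z. z \<in> ball 0 1 \<Longrightarrow> \<delta> \<le> norm (g z)" and up: "\<And>z. z \<in> ball 0 1 \<Longrightarrow> norm (g z) \<le> 1"
    and rad: "AE t in lborel. t \<in> {0..2*pi} \<longrightarrow> ((\<lambda>r. norm (g (of_real r * cis t))) \<longlongrightarrow> 1) (at_left 1)"
  shows "norm (g 0) = 1"
proof -
  have nz: "g z \<noteq> 0" if "z \<in> ball 0 1" for z
    using lo[OF that] \<open>0 < \<delta>\<close> by auto
  obtain l where l: "l holomorphic_on ball 0 1" and gl: "\<And>z. z \<in> ball 0 1 \<Longrightarrow> g z = exp (l z)"
    using simply_connected_imp_holomorphic_log[OF g _ _ nz] convex_imp_simply_connected[of "ball 0 1"]
      convex_imp_locally_path_connected[of "ball 0 1"] by (metis convex_ball)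
  have Re_l: "Re (l z) = ln (norm (g z))" if "z \<in> ball 0 1" for z
    using gl[OF that] by simp
  define r where "r = (\<lambda>n. 1 - 1 / (real n + 2))"
  have r: "0 < r n" "r n < 1" for n by (auto simp: r_def field_simps)
  have r_lim: "filterlim r (at_left 1) sequentially"
    unfolding r_def by real_asymp
  have in_ball: "of_real (r n) * cis t \<in> ball 0 1" for n t
    using r[of n] by (simp add: norm_mult)
  define S where "S = {0..2*pi}"
  define s where "s n t = indicator S t *\<^sub>R Re (l (of_real (r n) * cis t))" for n t
  have cont: "continuous_on S (\<lambda>t. Re (l (of_real (r n) * cis t)))" for n
    using in_ball by (intro continuous_intros continuous_on_compose2[OF holomorphic_on_imp_continuous_on[OF l]]) 
       (auto simp: cis_conv_exp intro!: continuous_intros)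
  have int: "(LINT t|lborel. s n t) = 2 * pi * Re (l 0)" for n
  proof -
    have "cball 0 (r n) \<subseteq> ball (0::complex) 1" using r[of n] by auto
    then have "((\<lambda>t. l (of_real (r n) * cis t)) has_integral (2 * pi * l 0)) {0..2*pi}"
      using l r[of n] by (intro has_integral_circle_mean holomorphic_on_imp_continuous_on)
        (auto elim!: holomorphic_on_subset)
    from has_integral_linear[OF this bounded_linear_Re]
    have "((\<lambda>t. Re (l (of_real (r n) * cis t))) has_integral (2 * pi * Re (l 0))) S"
      by (simp add: o_def S_def)
    moreover have "set_integrable lborel S (\<lambda>t. Re (l (of_real (r n) * cis t)))"
      using cont[of n] unfolding S_def by (rule borel_integrable_atLeastAtMost')
    ultimately show ?thesis
      using set_borel_integral_eq_integral[of S "\<lambda>t. Re (l (of_real (r n) * cis t))"]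
      by (simp add: set_lebesgue_integral_def s_def integral_unique)
  qed
  have "(\<lambda>n. LINT t|lborel. s n t) \<longlonglongrightarrow> (LINT t::real|lborel. 0::real)"
  proof (rule integral_dominated_convergence[where w = "\<lambda>t. indicator S t * \<bar>ln \<delta>\<bar>"])
    show "(\<lambda>t::real. 0::real) \<in> borel_measurable lborel" by simp
    show "s n \<in> borel_measurable lborel" for n
      unfolding s_def using borel_measurable_continuous_on_indicator[OF _ cont[of n]] by (simp add: S_def)
    show "integrable lborel (\<lambda>t. indicator S t * \<bar>ln \<delta>\<bar>)"
      by (simp add: S_def)
    show "AE t in lborel. (\<lambda>n. s n t) \<longlonglongrightarrow> 0"
      using rad
    proof eventually_elim
      fix t assume t: "t \<in> {0..2*pi} \<longrightarrow> ((\<lambda>r. norm (g (of_real r * cis t))) \<longlongrightarrow> 1) (at_left 1)"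
      show "(\<lambda>n. s n t) \<longlonglongrightarrow> 0"
      proof (cases "t \<in> S")
        case True
        then have "(\<lambda>n. norm (g (of_real (r n) * cis t))) \<longlonglongrightarrow> 1"
          using t filterlim_compose[OF _ r_lim] by (auto simp: S_def)
        then have "(\<lambda>n. ln (norm (g (of_real (r n) * cis t)))) \<longlonglongrightarrow> ln 1"
          by (rule tendsto_ln) simp
        then show ?thesis using True Re_l[OF in_ball] by (simp add: s_def)
      qed (simp add: s_def)
    qed
    show "AE t in lborel. norm (s n t) \<le> indicator S t * \<bar>ln \<delta>\<bar>" for n
    proof (rule AE_I2)
      fix t
      have "norm (g (of_real (r n) * cis t)) > 0"
        using nz[OF in_ball[of n t]] by simp
      then have "ln \<delta> \<le> ln (norm (g (of_real (r n) * cis t)))" "ln (norm (g (of_real (r n) * cis t))) \<le> 0"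
        using lo[OF in_ball[of n t]] up[OF in_ball[of n t]] \<open>0 < \<delta>\<close>
        by simp_all
      then show "norm (s n t) \<le> indicator S t * \<bar>ln \<delta>\<bar>"
        using Re_l[OF in_ball[of n t]] by (auto simp: s_def indicator_def)
    qed
  qed
  then have "2 * pi * Re (l 0) = 0"
    unfolding int by (simp add: LIMSEQ_const_iff)
  then show ?thesis using gl[of 0] by simp
qed

text \<open>The strict Schwarz lemma applies to t * k for 0 < t < 1, and t is then sent to
  1.\<close>

lemma Schwarz_Lemma_le:
  assumes k: "k holomorphic_on ball 0 1" "k 0 = 0" and le: "\<And>z. z \<in> ball 0 1 \<Longrightarrow> norm (k z) \<le> 1"
    and z: "z \<in> ball 0 1"
  shows "norm (k z) \<le> norm z"
proof (rule field_le_mult_one_interval)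
  fix t :: real assume t: "0 < t" "t < 1"
  have "norm (of_real t * k z) \<le> norm z"
  proof (rule Schwarz_Lemma(1))
    show "(\<lambda>z. of_real t * k z) holomorphic_on ball 0 1" by (intro holomorphic_intros k)
    show "norm (of_real t * k w) < 1" if "norm w < 1" for w
    proof -
      have "t * norm (k w) \<le> t" using le[of w] that t by (intro mult_left_le) auto
      then have "t * norm (k w) < 1" using t by linarith
      then show ?thesis using t by (simp add: norm_mult)
    qed
  qed (use k z in auto)
  then show "t * norm (k z) \<le> norm z" using t by (simp add: norm_mult)
qed

section \<open>Filled images of an inner function\<close>

text \<open>Since \<open>a\<close> lies in an unbounded component of the complement, the map (x - a)
  / |x - a| from \<open>K\<close> to the circle is null-homotopic and hence has a continuous
  argument; ln |x - a| becomes the real part. This is the topological input about points that stay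
  outside the filled images.\<close>

lemma continuous_logarithm_unbounded_component:
  fixes a :: complex
  assumes K: "compact K" and a: "a \<in> outside K"
  obtains g where "continuous_on K g" "\<And>x. x \<in> K \<Longrightarrow> x - a = exp (g x)"
proof -
  have aK: "a \<notin> K" and ub: "\<not> bounded (connected_component_set (- K) a)"
    using a by (auto simp: outside_def)
  have "\<exists>c. homotopic_with_canon (\<lambda>x. True) K (sphere 0 1) (\<lambda>x. inverse (norm (x - a)) *\<^sub>R (x - a)) (\<lambda>x. c)"
    using Borsuk_map_essential_bounded_component[OF K aK] ub by blast
  then obtain h where h: "continuous_on K h"
      "\<And>x. x \<in> K \<Longrightarrow> inverse (norm (x - a)) *\<^sub>R (x - a) = exp (\<i> * of_real (h x))"
    unfolding inessential_eq_continuous_logarithm_circle by metis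
  show thesis
  proof
    show "continuous_on K (\<lambda>x. of_real (ln (norm (x - a))) + \<i> * of_real (h x))"
      using h(1) aK by (intro continuous_intros) auto
    fix x assume x: "x \<in> K"
    have "norm (x - a) > 0" using x aK by auto
    then have "exp (of_real (ln (norm (x - a))) + \<i> * of_real (h x))
        = of_real (norm (x - a)) * (inverse (norm (x - a)) *\<^sub>R (x - a))"
      unfolding h(2)[OF x] exp_add exp_of_real by simp
    then show "x - a = exp (of_real (ln (norm (x - a))) + \<i> * of_real (h x))"
      using \<open>norm (x - a) > 0\<close> by (simp add: scaleR_conv_of_real)
  qed
qed

locale inner_fixing_0 =
  fixes f :: "complex \<Rightarrow> complex"
  assumes inner: "inner_function f" and f_0 [simp]: "f 0 = 0"
begin

lemma hol: "f holomorphic_on ball 0 1"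
  using inner by (simp add: inner_function_def)

lemma maps: "z \<in> ball 0 1 \<Longrightarrow> f z \<in> ball 0 1"
  using inner unfolding inner_function_def by blast

lemma radial: "AE t in lborel. t \<in> {0..2*pi} \<longrightarrow>
    ((\<lambda>r. norm (f (of_real r * cis t))) \<longlongrightarrow> 1) (at_left 1)"
proof -
  have "AE t in lborel. t \<in> {0..2 * pi} \<longrightarrow>
        (\<exists>l. ((\<lambda>r. f (complex_of_real r * cis t)) \<longlongrightarrow> l) (at_left 1) \<and> norm l = 1)"
    using inner by (simp add: inner_function_def)
  then show ?thesis by eventually_elim (auto dest: tendsto_norm)
qed

lemma not_constant: "\<not> f constant_on ball 0 1"
proof
  assume "f constant_on ball 0 1"
  then have f0: "f z = 0" if "z \<in> ball 0 1" for z
    using that f_0 by (metis constant_on_def centre_in_ball zero_less_one)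
  have "AE t in lborel. t \<notin> {0..2*pi}"
    using radial
  proof eventually_elim
    fix t assume t: "t \<in> {0..2*pi} \<longrightarrow> ((\<lambda>r. norm (f (of_real r * cis t))) \<longlongrightarrow> 1) (at_left 1)"
    have "\<forall>\<^sub>F r in at_left 1. norm (f (of_real r * cis t)) = 0"
      using eventually_at_left_real[of 0 1] by (rule eventually_mono) (auto simp: f0 norm_mult)
    then have "((\<lambda>r. norm (f (of_real r * cis t))) \<longlongrightarrow> 0) (at_left 1)"
      by (simp add: tendsto_eventually)
    then show "t \<notin> {0..2*pi}"
      using t tendsto_unique[OF trivial_limit_at_left_real] by fastforce
  qed
  then have "emeasure lborel {0..2*pi} = 0"
    by (subst (asm) AE_iff_measurable[of "{0..2*pi}"]) auto
  then show False by simp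
qed

lemma open_image: "open S \<Longrightarrow> S \<subseteq> ball 0 1 \<Longrightarrow> open (f ` S)"
  by (rule open_mapping_thm[OF hol _ _ _ _ not_constant]) auto

lemma compact_image: "r < 1 \<Longrightarrow> compact (f ` cball 0 r)"
  by (intro compact_continuous_image continuous_on_subset[OF holomorphic_on_imp_continuous_on[OF hol]]) auto

text \<open>
  The images of the discs of radius less than one, with their holes filled in, exhaust the unit disc.
  Since $f$ need not be surjective, this is what replaces surjectivity: it transfers bounds and locally
  uniform convergence from $u \circ f$ to $u$.
\<close>

lemma eventually_outside:
  assumes w0: "w0 \<in> ball 0 1"
  shows "\<exists>r. 0 < r \<and> r < 1 \<and> w0 \<notin> outside (f ` cball 0 r)"
proof (rule ccontr)
  assume "\<not> ?thesis"
  then have out: "w0 \<in> outside (f ` cball 0 r)" if "0 < r" "r < 1" for r using that by blast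
  have avoid: "f z \<noteq> w0" if "z \<in> ball 0 1" for z
  proof
    assume "f z = w0"
    then have "w0 \<in> f ` cball 0 ((1 + norm z) / 2)" using that by auto
    moreover have "w0 \<in> outside (f ` cball 0 ((1 + norm z) / 2))"
      using that by (intro out) (auto simp: add_pos_nonneg)
    ultimately show False using outside_no_overlap by blast
  qed
  have w0n: "norm w0 < 1" using w0 by simp
  have den: "1 - cnj w0 * w \<noteq> 0" "Re (1 - cnj w0 * w) > 0" if "w \<in> ball 0 1" for w
    using one_minus_nonzero[OF w0n, of w] Re_one_minus_pos[OF w0n, of w] that by auto
  \<comment> \<open>\<open>m\<close> is the disc automorphism exchanging 0 and \<open>w0\<close>; as
    \<open>f\<close> avoids \<open>w0\<close>, its composition with \<open>f\<close> has no
    zeros.\<close>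
  define m where "m w = (w0 - w) / (1 - cnj w0 * w)" for w
  have m_hol: "(\<lambda>z. m (f z)) holomorphic_on ball 0 1"
    unfolding m_def using maps den by (intro holomorphic_intros hol) blast
  have "m (f z) \<noteq> 0" if "z \<in> ball 0 1" for z
    using that avoid[OF that] den(1)[OF maps[OF that]] by (simp add: m_def)
  then obtain G where G: "G holomorphic_on ball 0 1" and Gm: "\<And>z. z \<in> ball 0 1 \<Longrightarrow> m (f z) = G z ^ 2"
    using simply_connected_imp_holomorphic_sqrt[OF m_hol] convex_imp_simply_connected[of "ball 0 1"]
      convex_imp_locally_path_connected[of "ball 0 1"] by (metis convex_ball)
  \<comment> \<open>\<open>G\<close> depends only on the value of \<open>f\<close>: the image of a
    closed disc carries a continuous square root \<open>q\<close> of \<open>m\<close>, and the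
    quotient of \<open>G\<close> by the composition of \<open>q\<close> with \<open>f\<close> is
    continuous with values 1 and -1 on a connected set.\<close>
  have factors: "G z1 = G z2" if z: "z1 \<in> ball 0 1" "z2 \<in> ball 0 1" "f z1 = f z2" for z1 z2
  proof -
    define r where "r = (1 + max (norm z1) (norm z2)) / 2"
    have r: "0 < r" "r < 1" "z1 \<in> cball 0 r" "z2 \<in> cball 0 r"
      using z norm_ge_zero[of z1] by (auto simp: r_def simp del: norm_ge_zero)
    have sub: "cball 0 r \<subseteq> ball (0::complex) 1" using r by auto
    obtain g where g: "continuous_on (f ` cball 0 r) g" "\<And>x. x \<in> f ` cball 0 r \<Longrightarrow> x - w0 = exp (g x)"
      using continuous_logarithm_unbounded_component[OF compact_image[OF r(2)] out[OF r(1,2)]] by blast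
    \<comment> \<open>The factor \<i> accounts for the sign in m w = -(w - w0) / (1 - cnj w0 w). The
      principal logarithm of the denominator is continuous because its real part is
      positive.\<close>
    define q where "q w = \<i> * exp (g w / 2) / exp (Ln (1 - cnj w0 * w) / 2)" for w
    have q2: "q w ^ 2 = m w" if "w \<in> f ` cball 0 r" for w
    proof -
      have wb: "w \<in> ball 0 1" using that sub maps by blast
      have "q w ^ 2 = - (exp (g w / 2) ^ 2) / exp (Ln (1 - cnj w0 * w) / 2) ^ 2"
        by (simp add: q_def power_mult_distrib power_divide)
      also have "\<dots> = - exp (g w) / exp (Ln (1 - cnj w0 * w))"
        by (simp flip: exp_double)
      also have "\<dots> = m w" using g(2)[OF that] den(1)[OF wb] by (simp add: m_def flip: g(2)[OF that])
      finally show ?thesis .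
    qed
    have contq: "continuous_on (cball 0 r) (\<lambda>z. q (f z))"
    proof -
      have cf: "continuous_on (cball 0 r) f"
        using hol sub by (meson continuous_on_subset holomorphic_on_imp_continuous_on)
      have "1 - cnj w0 * f x \<notin> \<real>\<^sub>\<le>\<^sub>0" if "x \<in> cball 0 r" for x
        using den(2)[OF maps] sub that by (force simp: complex_nonpos_Reals_iff)
      then show ?thesis unfolding q_def
        by (intro continuous_intros cf continuous_on_compose2[OF g(1) cf]) auto
    qed
    define R where "R z = G z / q (f z)" for z
    have qnz: "q w \<noteq> 0" for w by (simp add: q_def)
    have "continuous_on (cball 0 r) R"
      unfolding R_def using qnz G sub
      by (intro continuous_intros contq) (auto intro: continuous_on_subset holomorphic_on_imp_continuous_on)
    moreover have R2: "R z = 1 \<or> R z = -1" if "z \<in> cball 0 r" for z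
    proof -
      have "R z ^ 2 = 1"
        using Gm[of z] q2[of "f z"] that sub qnz[of "f z"] by (auto simp: R_def power_divide)
      then show ?thesis by (simp add: power2_eq_1_iff)
    qed
    moreover have "finite (R ` cball 0 r)"
      by (rule finite_subset[of _ "{1,-1}"]) (use R2 in blast)+
    ultimately have "R constant_on cball 0 r"
      by (intro continuous_finite_range_constant) auto
    then have "R z1 = R z2" using r by (auto simp: constant_on_def)
    then show ?thesis using z qnz by (simp add: R_def)
  qed
  define p where "p = G 0"
  have p2: "p ^ 2 = w0" using Gm[of 0] by (simp add: p_def m_def)
  have w0_nz: "w0 \<noteq> 0" using avoid[of 0] by auto
  have p_less: "norm p < 1"
    using w0n p2 by (metis norm_power norm_ge_zero power_less_one_iff zero_neq_numeral)
  have m_eq: "norm (m w) = norm (blaschke_factor w0 w)" for w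
    by (simp add: m_def blaschke_factor_def norm_divide norm_minus_commute)
  have norm_G: "norm (G z) = sqrt (norm (blaschke_factor w0 (f z)))" if "z \<in> ball 0 1" for z
    using Gm[OF that] by (simp flip: m_eq add: norm_power)
  have G_less: "norm (G z) < 1" if "z \<in> ball 0 1" for z
    using norm_blaschke_factor_less_1[OF w0n, of "f z"] maps[OF that] norm_G[OF that] by simp
txt \<open>
  If $w_0$ stays outside the filled images, $G = \sqrt{m \circ f}$ factors through $f$. Solving for $f$
  shows that $f$ is a product of two Blaschke factors in $G$. The one called $k$ has no zeros, since
  $f(z) = 0$ forces $G(z) = p$ rather than $-p$; being bounded below with unimodular radial limits,
  it would have $|k(0)| = 1$.
\<close>
  define k where "k z = blaschke_factor (-p) (G z)" for z
  have f_eq: "f z = k z * (- blaschke_factor p (G z))" if "z \<in> ball 0 1" for z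
  proof -
    have "w0 - f z = G z ^ 2 * (1 - cnj w0 * f z)"
      using Gm[OF that] den[OF maps[OF that]] by (simp add: m_def field_simps)
    then have "f z * (1 - cnj p * G z) * (1 + cnj p * G z) = (p - G z) * (p + G z)"
      by (simp flip: p2 add: algebra_simps power2_eq_square)
    moreover have nz: "1 - cnj p * G z \<noteq> 0" "1 + cnj p * G z \<noteq> 0"
      using one_minus_nonzero[of p "G z"] one_minus_nonzero[of "-p" "G z"] p_less G_less[OF that] by auto
    moreover have "a = (d / c) * - ((- b) / e)" if "a * e * c = b * d" "e \<noteq> 0" "c \<noteq> 0" for a b c d e :: complex
      using that by (simp add: field_simps)
    ultimately have "f z = (p + G z) / (1 + cnj p * G z) * - ((- (p - G z)) / (1 - cnj p * G z))"
      by blast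
    then show ?thesis
      by (simp add: k_def blaschke_factor_def add.commute)
  qed
  have k_ge_f: "norm (f z) \<le> norm (k z)" if "z \<in> ball 0 1" for z
    unfolding f_eq[OF that] norm_mult norm_minus_cancel
    using norm_blaschke_factor_le_1[OF p_less, of "G z"] G_less[OF that]
    by (intro mult_left_le) auto
  have p_pos: "norm p > 0" using w0_nz p2 by auto
  have "isCont G 0"
    using holomorphic_on_imp_continuous_on[OF G] by (simp add: continuous_on_eq_continuous_at)
  then obtain d where d: "d > 0" "\<And>z. norm z < d \<Longrightarrow> norm (G z - p) < norm p"
    using p_pos unfolding p_def continuous_at_eps_delta by (metis diff_zero dist_norm)
  define s where "s = min d 1"
  \<comment> \<open>By the open mapping theorem every value of modulus below \<open>e\<close> is
    attained near 0, where \<open>G\<close> is close to \<open>p\<close>. As \<open>G\<close>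
    depends only on the value of \<open>f\<close>, it is close to \<open>p\<close> wherever |f| < e,
    which bounds \<open>k\<close> from below there; elsewhere |k| >= |f| >= e.\<close>
  have "open (f ` ball 0 s)" "0 \<in> f ` ball 0 s"
    using d(1) by (auto intro!: open_image image_eqI[of _ _ 0] simp: s_def)
  then obtain e where e: "e > 0" "ball 0 e \<subseteq> f ` ball 0 s"
    using open_contains_ball by metis
  have k_bound: "min e (norm p / 2) \<le> norm (k z)" if z: "z \<in> ball 0 1" for z
  proof (cases "norm (f z) < e")
    case True
    then obtain z' where z': "z' \<in> ball 0 s" "f z = f z'" using e(2) by auto
    then have "G z = G z'" using factors[OF z, of z'] by (auto simp: s_def)
    then have "norm (G z - p) < norm p" using d(2)[of z'] z' by (auto simp: s_def)
    then have "norm p \<le> norm (p + G z)"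
      using norm_triangle_ineq2[of "2 * p" "p - G z"] by (simp add: norm_minus_commute norm_mult)
    moreover have "norm (1 + cnj p * G z) \<le> 2"
    proof -
      have "norm (cnj p * G z) \<le> 1 * 1"
        unfolding norm_mult complex_mod_cnj using p_less G_less[OF z] by (intro mult_mono) auto
      then show ?thesis using norm_triangle_ineq[of 1 "cnj p * G z"] by simp
    qed
    moreover have "1 + cnj p * G z \<noteq> 0"
      using one_minus_nonzero[of "-p" "G z"] p_less G_less[OF z] by auto
    ultimately have "norm p / 2 \<le> norm (k z)"
      unfolding k_def blaschke_factor_def norm_divide by (intro frac_le) (auto simp: add.commute)
    then show ?thesis by simp
  qed (use k_ge_f[OF z] in simp)
  have "norm (k 0) = 1"
  proof (rule unimodular_at_0)
    show "k holomorphic_on ball 0 1"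
      using holomorphic_on_compose_gen[OF G blaschke_factor_holomorphic[of "-p"], unfolded o_def] G_less p_less
      by (auto simp: k_def[abs_def] image_subset_iff)
    show "0 < min e (norm p / 2)" using e(1) p_pos by simp
    show "norm (k z) \<le> 1" if "z \<in> ball 0 1" for z
      unfolding k_def using p_less G_less[OF that] by (intro norm_blaschke_factor_le_1) auto
    show "AE t in lborel. t \<in> {0..2*pi} \<longrightarrow> ((\<lambda>r. norm (k (of_real r * cis t))) \<longlongrightarrow> 1) (at_left 1)"
      using radial
    proof eventually_elim
      fix t assume t: "t \<in> {0..2*pi} \<longrightarrow> ((\<lambda>r. norm (f (of_real r * cis t))) \<longlongrightarrow> 1) (at_left 1)"
      have ev: "\<forall>\<^sub>F r in at_left 1. of_real r * cis t \<in> ball 0 1"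
        using eventually_at_left_real[of 0 1] by (rule eventually_mono) (auto simp: norm_mult)
      show "t \<in> {0..2*pi} \<longrightarrow> ((\<lambda>r. norm (k (of_real r * cis t))) \<longlongrightarrow> 1) (at_left 1)"
      proof
        assume "t \<in> {0..2*pi}"
        with t have "((\<lambda>r. norm (f (of_real r * cis t))) \<longlongrightarrow> 1) (at_left 1)" by blast
        then have "((\<lambda>r. norm (blaschke_factor w0 (f (of_real r * cis t)))) \<longlongrightarrow> 1) (at_left 1)"
          using maps by (intro tendsto_norm_blaschke_factor w0n eventually_mono[OF ev]) (auto intro: less_imp_le)
        then have "((\<lambda>r. sqrt (norm (blaschke_factor w0 (f (of_real r * cis t))))) \<longlongrightarrow> sqrt 1) (at_left 1)"
          by (rule tendsto_real_sqrt)
        then have "((\<lambda>r. norm (G (of_real r * cis t))) \<longlongrightarrow> 1) (at_left 1)"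
          unfolding real_sqrt_one
        proof (rule Lim_transform_eventually)
          show "\<forall>\<^sub>F r in at_left 1. sqrt (norm (blaschke_factor w0 (f (of_real r * cis t)))) = norm (G (of_real r * cis t))"
            using ev by (rule eventually_mono) (rule norm_G[symmetric])
        qed
        then show "((\<lambda>r. norm (k (of_real r * cis t))) \<longlongrightarrow> 1) (at_left 1)"
          unfolding k_def using p_less G_less
          by (intro tendsto_norm_blaschke_factor eventually_mono[OF ev]) (auto intro: less_imp_le)
      qed
    qed
  qed (use k_bound in auto)
  moreover have "norm (k 0) < 1"
    unfolding k_def using p_less G_less[of 0] by (intro norm_blaschke_factor_less_1) auto
  ultimately show False by simp
qed
end

section \<open>Series of iterates\<close>

definition locally_uniform_limit :: "(nat \<Rightarrow> complex \<Rightarrow> complex) \<Rightarrow> (complex \<Rightarrow> complex) \<Rightarrow> bool" where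
  "locally_uniform_limit u g \<longleftrightarrow>
     (\<forall>K. compact K \<and> K \<subseteq> ball 0 1 \<longrightarrow> uniform_limit K u g sequentially)"

lemma locally_uniform_limit_LIMSEQ:
  assumes "locally_uniform_limit u g" "z \<in> ball 0 1"
  shows "(\<lambda>n. u n z) \<longlonglongrightarrow> g z"
proof -
  have "compact {z}" "{z} \<subseteq> ball 0 1" using assms(2) by auto
  then have "uniform_limit {z} u g sequentially"
    using assms(1) unfolding locally_uniform_limit_def by blast
  then show ?thesis by (rule tendsto_uniform_limitI) simp
qed

lemma locally_uniform_limit_holomorphic:
  assumes "\<And>n. u n holomorphic_on ball 0 1" "locally_uniform_limit u g"
  shows "g holomorphic_on ball 0 1"
proof (rule holomorphic_uniform_sequence[OF open_ball assms(1)])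
  fix x :: complex assume "x \<in> ball 0 1"
  then obtain d where "d > 0" "cball x d \<subseteq> ball 0 1"
    using open_contains_cball[of "ball (0::complex) 1"] by blast
  then show "\<exists>d>0. cball x d \<subseteq> ball 0 1 \<and> uniform_limit (cball x d) u g sequentially"
    using assms(2) by (auto simp: locally_uniform_limit_def)
qed

lemma locally_uniform_limit_cong:
  assumes "locally_uniform_limit u g" "\<And>n z. z \<in> ball 0 1 \<Longrightarrow> u n z = v n z" "\<And>z. z \<in> ball 0 1 \<Longrightarrow> g z = h z"
  shows "locally_uniform_limit v h"
  unfolding locally_uniform_limit_def
proof safe
  fix K :: "complex set" assume K: "compact K" "K \<subseteq> ball 0 1"
  have "uniform_limit K u g sequentially \<longleftrightarrow> uniform_limit K v h sequentially"
    by (rule uniform_limit_cong') (use assms K in auto)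
  then show "uniform_limit K v h sequentially"
    using assms(1) K by (auto simp: locally_uniform_limit_def)
qed

context inner_fixing_0 begin

text \<open>The interiors of the filled images increase with the radius and cover \<open>K\<close>,
  so by compactness one radius suffices. Points in a hole are interior because holes are open, and
  points of the image become interior for a slightly larger radius by the open mapping
  theorem.\<close>

lemma hull_uniform:
  assumes K: "compact K" "K \<subseteq> ball 0 1"
  obtains r where "0 < r" "r < 1" "K \<inter> outside (f ` cball 0 r) = {}"
proof -
  define V where "V r = interior (- outside (f ` cball 0 r))" for r
  have V_mono: "V r \<subseteq> V s" if "r \<le> s" for r s
  proof -
    have "cball 0 r \<subseteq> cball (0::complex) s" using that by auto
    then show ?thesis
      unfolding V_def by (intro interior_mono) (use outside_mono[OF image_mono] in blast)
  qed
  have cover: "K \<subseteq> \<Union> (V ` {0<..<1})"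
  proof
    fix w assume "w \<in> K"
    then obtain r where r: "0 < r" "r < 1" "w \<notin> outside (f ` cball 0 r)"
      using eventually_outside K(2) by blast
    define s where "s = (r + 1) / 2"
    have s: "r < s" "s < 1" using r by (auto simp: s_def)
    have "w \<in> f ` ball 0 s \<union> inside (f ` cball 0 r)"
    proof -
      have "w \<in> f ` cball 0 r \<union> inside (f ` cball 0 r)" using r(3) by (simp add: union_with_inside)
      moreover have "cball 0 r \<subseteq> ball (0::complex) s" using s by auto
      ultimately show ?thesis by blast
    qed
    moreover have "f ` ball 0 s \<union> inside (f ` cball 0 r) \<subseteq> V s"
      unfolding V_def
    proof (rule interior_maximal)
      have "f ` cball 0 s \<union> inside (f ` cball 0 s) = - outside (f ` cball 0 s)"
        by (rule union_with_inside)
      moreover have "f ` cball 0 r \<union> inside (f ` cball 0 r) = - outside (f ` cball 0 r)"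
        by (rule union_with_inside)
      moreover have "outside (f ` cball 0 s) \<subseteq> outside (f ` cball 0 r)"
        using s by (intro outside_mono image_mono) auto
      moreover have "ball 0 s \<subseteq> cball (0::complex) s" by auto
      ultimately show "f ` ball 0 s \<union> inside (f ` cball 0 r) \<subseteq> - outside (f ` cball 0 s)" by blast
      show "open (f ` ball 0 s \<union> inside (f ` cball 0 r))"
        using s r compact_image[of r] by (intro open_Un open_image open_inside compact_imp_closed) auto
    qed
    moreover have "s \<in> {0<..<1}" using s r by auto
    ultimately show "w \<in> \<Union> (V ` {0<..<1})" by blast
  qed
  obtain C where C: "C \<subseteq> {0<..<1}" "finite C" "K \<subseteq> \<Union> (V ` C)"
    using compactE_image[OF K(1) _ cover] by (auto simp: V_def)
  \<comment> \<open>The element 1/2 keeps the maximum meaningful when the subcover is empty, as may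
    happen for empty \<open>K\<close>.\<close>
  define r where "r = Max (insert (1/2) C)"
  have "r \<in> insert (1/2) C" unfolding r_def using C by (intro Max_in) auto
  then have "0 < r" "r < 1" using C by auto
  moreover have "K \<subseteq> V r"
  proof
    fix w assume "w \<in> K"
    then obtain s where "s \<in> C" "w \<in> V s" using C by auto
    moreover have "s \<le> r" unfolding r_def using C \<open>s \<in> C\<close> by (intro Max_ge) auto
    ultimately show "w \<in> V r" using V_mono by auto
  qed
  then have "K \<inter> outside (f ` cball 0 r) = {}"
    unfolding V_def using interior_subset by blast
  ultimately show thesis by (rule that)
qed

text \<open>The holes of the image have their frontier inside the image, so the maximum principle
  extends the bound into them. Convexity of the unit disc ensures that the holes stay where
  \<open>u\<close> is holomorphic.\<close>

lemma hull_bound: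
  assumes u: "u holomorphic_on ball 0 1" and r: "r < 1"
    and le: "\<And>z. z \<in> cball 0 r \<Longrightarrow> norm (u (f z)) \<le> M" and w: "w \<notin> outside (f ` cball 0 r)"
  shows "norm (u w) \<le> M"
proof -
  define K where "K = f ` cball 0 r"
  have "cball (0::complex) r \<subseteq> ball 0 1" using r by auto
  then have K: "compact K" "K \<subseteq> ball 0 1"
    using compact_image[OF r] maps unfolding K_def by blast+
  have "- ball 0 1 \<subseteq> outside K"
    using outside_mono[OF K(2)] outside_convex[of "ball (0::complex) 1"] by simp
  then have sub: "K \<union> inside K \<subseteq> ball 0 1"
    unfolding union_with_inside by blast
  have "w \<in> K \<union> inside K" using w by (simp add: K_def union_with_inside)
  then show ?thesis
  proof
    assume w: "w \<in> inside K"
    show ?thesis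
    proof (rule maximum_modulus_frontier[OF _ _ _ _ w])
      show "u holomorphic_on interior (inside K)"
        using u by (rule holomorphic_on_subset) (use sub interior_subset in blast)
      show "continuous_on (closure (inside K)) u"
        using holomorphic_on_imp_continuous_on[OF u]
        by (rule continuous_on_subset) (use sub closure_inside_subset[OF compact_imp_closed[OF K(1)]] in blast)
      show "bounded (inside K)" using K by (simp add: bounded_inside compact_imp_bounded)
      show "norm (u z) \<le> M" if "z \<in> frontier (inside K)" for z
        using frontier_inside_subset[OF compact_imp_closed[OF K(1)]] that le by (auto simp: K_def)
    qed
  qed (use le in \<open>auto simp: K_def\<close>)
qed

lemma bound_from_image:
  assumes "u holomorphic_on ball 0 1" "\<And>z. z \<in> ball 0 1 \<Longrightarrow> norm (u (f z)) \<le> M" "w \<in> ball 0 1"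
  shows "norm (u w) \<le> M"
proof -
  obtain r where r: "0 < r" "r < 1" "w \<notin> outside (f ` cball 0 r)" using eventually_outside[OF assms(3)] by blast
  have "cball (0::complex) r \<subseteq> ball 0 1" using r by auto
  then show ?thesis using hull_bound[OF assms(1) r(2) _ r(3)] assms(2) by blast
qed

text \<open>The bound on filled images is applied to the differences \<open>u m - u n\<close>: a
  uniform Cauchy estimate for the compositions on one closed disc becomes one for \<open>u\<close>
  on a given compact set. The limit is defined pointwise, so the same \<open>G\<close> serves all
  compact sets.\<close>

lemma locally_uniform_limit_from_image:
  assumes u: "\<And>n. u n holomorphic_on ball 0 1" and lim: "locally_uniform_limit (\<lambda>n z. u n (f z)) g"
  obtains G where "G holomorphic_on ball 0 1" "locally_uniform_limit u G" "\<And>z. z \<in> ball 0 1 \<Longrightarrow> G (f z) = g z"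
proof -
  define G where "G w = lim (\<lambda>n. u n w)" for w
  have G: "locally_uniform_limit u G"
    unfolding locally_uniform_limit_def
  proof safe
    fix K :: "complex set" assume K: "compact K" "K \<subseteq> ball 0 1"
    obtain r where r: "0 < r" "r < 1" "K \<inter> outside (f ` cball 0 r) = {}" using hull_uniform[OF K] .
    have "cball (0::complex) r \<subseteq> ball 0 1" using r by auto
    then have "uniform_limit (cball 0 r) (\<lambda>n z. u n (f z)) g sequentially"
      using lim by (simp add: locally_uniform_limit_def)
    then have cauchy: "uniformly_Cauchy_on (cball 0 r) (\<lambda>n z. u n (f z))"
      using uniformly_convergent_Cauchy uniformly_convergent_on_def by blast
    have "uniformly_Cauchy_on K u"
      unfolding uniformly_Cauchy_on_def
    proof (intro allI impI)
      fix e :: real assume "e > 0"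
      then obtain M where M: "\<And>x m n. x \<in> cball 0 r \<Longrightarrow> m \<ge> M \<Longrightarrow> n \<ge> M \<Longrightarrow> dist (u m (f x)) (u n (f x)) < e / 2"
        using cauchy unfolding uniformly_Cauchy_on_def by (meson half_gt_zero)
      have "dist (u m w) (u n w) < e" if "w \<in> K" "m \<ge> M" "n \<ge> M" for w m n
      proof -
        have "norm ((\<lambda>w. u m w - u n w) w) \<le> e / 2"
        proof (rule hull_bound[of "\<lambda>w. u m w - u n w", OF _ r(2)])
          show "(\<lambda>w. u m w - u n w) holomorphic_on ball 0 1" by (intro holomorphic_intros u)
          show "norm (u m (f z) - u n (f z)) \<le> e / 2" if "z \<in> cball 0 r" for z
            using M[OF that \<open>m \<ge> M\<close> \<open>n \<ge> M\<close>] by (simp add: dist_norm)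
        qed (use r that in auto)
        then show ?thesis using \<open>e > 0\<close> by (simp add: dist_norm)
      qed
      then show "\<exists>M. \<forall>x\<in>K. \<forall>m\<ge>M. \<forall>n\<ge>M. dist (u m x) (u n x) < e" by blast
    qed
    then show "uniform_limit K u G sequentially"
      unfolding G_def[abs_def] using Cauchy_uniformly_convergent uniformly_convergent_uniform_limit_iff by blast
  qed
  show thesis
  proof (rule that[OF _ G])
    show "G holomorphic_on ball 0 1" by (rule locally_uniform_limit_holomorphic[OF u G])
    show "G (f z) = g z" if "z \<in> ball 0 1" for z
      using locally_uniform_limit_LIMSEQ[OF G maps[OF that]] locally_uniform_limit_LIMSEQ[OF lim that]
      by (rule LIMSEQ_unique)
  qed
qed

section \<open>Partial sums of the series and uniqueness of the coefficients\<close>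

definition iter_sum :: "(nat \<Rightarrow> complex) \<Rightarrow> nat \<Rightarrow> complex \<Rightarrow> complex" where
  "iter_sum b N z = (\<Sum>n=1..N. b n * (f ^^ n) z)"

lemma iter_in_ball: "z \<in> ball 0 1 \<Longrightarrow> (f ^^ n) z \<in> ball 0 1"
  by (induction n) (use maps in auto)

lemma iter_holomorphic: "(f ^^ n) holomorphic_on ball 0 1"
proof (induction n)
  case (Suc n)
  show ?case
    using holomorphic_on_compose_gen[OF Suc hol] iter_in_ball by (auto simp: o_def image_subset_iff)
qed (auto simp: id_def)

lemma iter_sum_holomorphic: "iter_sum b N holomorphic_on ball 0 1"
  unfolding iter_sum_def[abs_def] by (intro holomorphic_intros iter_holomorphic)

lemma iter_sum_Suc: "iter_sum b (Suc N) z = b 1 * f z + iter_sum (\<lambda>n. b (Suc n)) N (f z)"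
proof -
  have "iter_sum b (Suc N) z = b 1 * f z + (\<Sum>n=2..Suc N. b n * (f ^^ n) z)"
    unfolding iter_sum_def by (subst sum.atLeast_Suc_atMost) (auto simp: numeral_2_eq_2)
  also have "(\<Sum>n=2..Suc N. b n * (f ^^ n) z) = (\<Sum>n=1..N. b (Suc n) * (f ^^ Suc n) z)"
    by (simp only: numeral_2_eq_2 One_nat_def sum.shift_bounds_cl_Suc_ivl)
  finally show ?thesis by (simp add: iter_sum_def funpow_swap1)
qed

text \<open>Each partial sum is a function of f(z), so the limit is one too. The function
  \<open>h\<close> obtained after removing the leading term is the sum of the shifted series in its
  own right, which permits iteration.\<close>

lemma iter_sum_shift:
  assumes "locally_uniform_limit (iter_sum b) g"
  obtains h where "h holomorphic_on ball 0 1" "locally_uniform_limit (iter_sum (\<lambda>n. b (Suc n))) h"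
    "\<And>z. z \<in> ball 0 1 \<Longrightarrow> g z = b 1 * f z + h (f z)"
proof -
  have "locally_uniform_limit (\<lambda>N. iter_sum b (Suc N)) g"
    using assms by (auto simp: locally_uniform_limit_def filterlim_sequentially_Suc[of "iter_sum b"])
  then have "locally_uniform_limit (\<lambda>N z. (\<lambda>w. b 1 * w + iter_sum (\<lambda>n. b (Suc n)) N w) (f z)) g"
    by (simp add: iter_sum_Suc[abs_def])
  from locally_uniform_limit_from_image[OF _ this]
  obtain G where G: "G holomorphic_on ball 0 1"
    "locally_uniform_limit (\<lambda>N w. b 1 * w + iter_sum (\<lambda>n. b (Suc n)) N w) G"
    "\<And>z. z \<in> ball 0 1 \<Longrightarrow> G (f z) = g z"
    by (auto intro!: holomorphic_intros iter_sum_holomorphic)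
  show thesis
  proof (rule that)
    show "(\<lambda>w. G w - b 1 * w) holomorphic_on ball 0 1" by (intro holomorphic_intros G)
    show "locally_uniform_limit (iter_sum (\<lambda>n. b (Suc n))) (\<lambda>w. G w - b 1 * w)"
      unfolding locally_uniform_limit_def
    proof safe
      fix K :: "complex set" assume "compact K" "K \<subseteq> ball 0 1"
      then have "uniform_limit K (\<lambda>N w. b 1 * w + iter_sum (\<lambda>n. b (Suc n)) N w) G sequentially"
        using G(2) by (auto simp: locally_uniform_limit_def)
      then have "uniform_limit K (\<lambda>N w. (b 1 * w + iter_sum (\<lambda>n. b (Suc n)) N w) - b 1 * w) (\<lambda>w. G w - b 1 * w) sequentially"
        by (intro uniform_limit_intros)
      then show "uniform_limit K (iter_sum (\<lambda>n. b (Suc n))) (\<lambda>w. G w - b 1 * w) sequentially" by simp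
    qed
    show "g z = b 1 * f z + (G (f z) - b 1 * f z)" if "z \<in> ball 0 1" for z using G(3)[OF that] by simp
  qed
qed

lemma iter_sum_limit_zero_step:
  assumes nr: "\<not> rotation f" and lim: "locally_uniform_limit (iter_sum b) (\<lambda>z. 0)"
  shows "b 1 = 0" "locally_uniform_limit (iter_sum (\<lambda>n. b (Suc n))) (\<lambda>z. 0)"
proof -
  obtain h where h: "h holomorphic_on ball 0 1" "locally_uniform_limit (iter_sum (\<lambda>n. b (Suc n))) h"
    "\<And>z. z \<in> ball 0 1 \<Longrightarrow> 0 = b 1 * f z + h (f z)"
    using iter_sum_shift[OF lim] by metis
  \<comment> \<open>The function vanishes on the image of \<open>f\<close>, and the bound 0 carries
    over to the whole disc.\<close>
  have "norm (b 1 * w + h w) \<le> 0" if "w \<in> ball 0 1" for w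
  proof (rule bound_from_image[of "\<lambda>w. b 1 * w + h w", OF _ _ that])
    show "(\<lambda>w. b 1 * w + h w) holomorphic_on ball 0 1" by (intro holomorphic_intros h(1))
    show "norm (b 1 * f z + h (f z)) \<le> 0" if "z \<in> ball 0 1" for z
      unfolding h(3)[OF that, symmetric] by simp
  qed
  then have h_eq: "h w = - b 1 * w" if "w \<in> ball 0 1" for w
    using that by (simp add: eq_neg_iff_add_eq_0 add.commute)
  obtain k where k: "k holomorphic_on ball 0 1" "\<And>z. z \<in> ball 0 1 \<Longrightarrow> h z = b (Suc 1) * f z + k (f z)"
    using iter_sum_shift[OF h(2)] by metis
  show b1: "b 1 = 0"
  proof (rule ccontr)
    assume nz: "b 1 \<noteq> 0"
    \<comment> \<open>As h(z) = - b 1 * z is itself a function of f(z), division by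
      \<open>b 1\<close> produces a left inverse of \<open>f\<close> up to sign. Its bound by 1 and
      the Schwarz lemma give |z| <= |f(z)|, the case of equality in the Schwarz lemma for
      \<open>f\<close>.\<close>
    define K where "K w = (b (Suc 1) * w + k w) / b 1" for w
    have K_hol: "K holomorphic_on ball 0 1" unfolding K_def[abs_def] by (intro holomorphic_intros k nz)
    have K_f: "K (f z) = - z" if "z \<in> ball 0 1" for z
      using k(2)[OF that] h_eq[OF that] nz by (simp add: K_def field_simps)
    have "norm (K w) \<le> 1" if "w \<in> ball 0 1" for w
      by (rule bound_from_image[OF K_hol _ that]) (simp add: K_f)
    moreover have "K 0 = 0" using K_f[of 0] by simp
    ultimately have "norm (K w) \<le> norm w" if "w \<in> ball 0 1" for w
      using Schwarz_Lemma_le[OF K_hol] that by blast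
    then have ge: "norm z \<le> norm (f z)" if "z \<in> ball 0 1" for z
      using K_f[OF that] maps[OF that] by (metis norm_minus_cancel)
    have less: "norm (f z) < 1" if "norm z < 1" for z using maps[of z] that by simp
    have "norm (f (1/2)) = norm (1/2 :: complex)"
      using ge[of "1/2"] Schwarz_Lemma(1)[OF hol f_0 less, of "1/2"] by (simp add: norm_divide)
    then have "\<exists>\<alpha>. (\<forall>z. norm z < 1 \<longrightarrow> f z = \<alpha> * z) \<and> norm \<alpha> = 1"
      by (intro Schwarz_Lemma(3)[OF hol f_0 less, of 0] disjI1 exI[of _ "1/2"]) (auto simp: norm_divide)
    then show False using nr by (auto simp: rotation_def)
  qed
  show "locally_uniform_limit (iter_sum (\<lambda>n. b (Suc n))) (\<lambda>z. 0)"
    by (rule locally_uniform_limit_cong[OF h(2)]) (simp_all only: h_eq b1, simp)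
qed

lemma iter_sum_limit_zero:
  assumes "\<not> rotation f" "locally_uniform_limit (iter_sum b) (\<lambda>z. 0)"
  shows "b (Suc n) = 0"
proof -
  have "locally_uniform_limit (iter_sum (\<lambda>m. b (n + m))) (\<lambda>z. 0)"
  proof (induction n)
    case (Suc n)
    then show ?case using iter_sum_limit_zero_step(2)[OF assms(1) Suc] by simp
  qed (use assms in simp)
  from iter_sum_limit_zero_step(1)[OF assms(1) this] show ?thesis by simp
qed

end

section \<open>Sums in the disc algebra force finite Blaschke products\<close>

lemma blaschke_factor_minus_inverse:
  assumes "norm a < 1" "norm z < 1"
  shows "blaschke_factor (-a) (blaschke_factor a z) = z"
proof -
  have nz: "1 - cnj a * z \<noteq> 0" "1 - cnj a * a \<noteq> 0"
    using one_minus_nonzero[of a z] one_minus_nonzero[of a a] assms by auto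
  define d where "d = 1 - cnj a * z"
  have "blaschke_factor a z + a = z * (1 - cnj a * a) / d"
    using nz by (simp add: blaschke_factor_def d_def field_simps)
  moreover have "1 + cnj a * blaschke_factor a z = (1 - cnj a * a) / d"
    using nz by (simp add: blaschke_factor_def d_def field_simps)
  ultimately show ?thesis
    using nz by (simp add: blaschke_factor_def[of "-a"] d_def)
qed

text \<open>The inverse automorphism moves the zero to 0, where the Schwarz lemma bounds the
  quotient by z; at the origin that bound follows by continuity.\<close>

lemma divide_blaschke_factor:
  assumes h: "h holomorphic_on ball 0 1" and le: "\<And>z. z \<in> ball 0 1 \<Longrightarrow> norm (h z) \<le> 1"
    and a: "norm a < 1" and ha: "h a = 0"
  obtains g where "g holomorphic_on ball 0 1" "\<And>z. z \<in> ball 0 1 \<Longrightarrow> norm (g z) \<le> 1"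
    "\<And>z. z \<in> ball 0 1 \<Longrightarrow> h z = blaschke_factor a z * g z"
proof -
  have a': "norm (-a) < 1" using a by simp
  have in_ball: "blaschke_factor b z \<in> ball 0 1" if "norm b < 1" "z \<in> ball 0 1" for b z
    using norm_blaschke_factor_less_1[OF that(1), of z] that by simp
  define H where "H w = h (blaschke_factor (-a) w)" for w
  have H: "H holomorphic_on ball 0 1"
    using holomorphic_on_compose_gen[OF blaschke_factor_holomorphic[OF a'] h] in_ball[OF a']
    by (auto simp: H_def[abs_def] o_def image_subset_iff)
  have H0: "H 0 = 0" using ha by (simp add: H_def blaschke_factor_def)
  have H_le: "norm (H w) \<le> norm w" if "w \<in> ball 0 1" for w
    using Schwarz_Lemma_le[OF H H0 _ that] le in_ball[OF a'] by (simp add: H_def)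
  obtain k where k: "k holomorphic_on ball 0 1" "\<And>w. norm w < 1 \<Longrightarrow> H w = w * k w"
    using Schwarz3[OF H H0] by metis
  have k_le: "norm (k w) \<le> 1" if w: "w \<in> ball 0 1" for w
  proof (cases "w = 0")
    case False
    then show ?thesis using H_le[OF w] k(2)[of w] w by (simp add: norm_mult)
  next
    case True
    have "isCont k 0"
      using holomorphic_on_imp_continuous_on[OF k(1)] by (simp add: continuous_on_eq_continuous_at)
    then have "((\<lambda>w. norm (k w)) \<longlongrightarrow> norm (k 0)) (at 0)"
      by (intro tendsto_norm) (simp add: isCont_def)
    moreover have "\<forall>\<^sub>F w in at 0. norm (k w) \<le> 1"
    proof -
      have "\<forall>\<^sub>F w in at (0::complex). w \<in> ball 0 1 - {0}"
        by (rule eventually_at_in_open) auto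
      then show ?thesis
      proof eventually_elim
        case (elim w)
        then show ?case using H_le[of w] k(2)[of w] by (simp add: norm_mult)
      qed
    qed
    ultimately have "norm (k 0) \<le> 1" by (rule tendsto_upperbound) simp
    with True show ?thesis by simp
  qed
  show thesis
  proof (rule that[of "\<lambda>z. k (blaschke_factor a z)"])
    show "(\<lambda>z. k (blaschke_factor a z)) holomorphic_on ball 0 1"
      using holomorphic_on_compose_gen[OF blaschke_factor_holomorphic[OF a] k(1)] in_ball[OF a]
      by (auto simp: o_def image_subset_iff)
    show "norm (k (blaschke_factor a z)) \<le> 1" if "z \<in> ball 0 1" for z
      by (rule k_le[OF in_ball[OF a that]])
    show "h z = blaschke_factor a z * k (blaschke_factor a z)" if "z \<in> ball 0 1" for z
      using k(2)[of "blaschke_factor a z"] in_ball[OF a that] blaschke_factor_minus_inverse[OF a, of z] that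
      by (simp add: H_def)
  qed
qed

lemma AE_lborel_obtain:
  assumes "AE t in lborel. P t" "a < (b::real)"
  obtains t where "a < t" "t < b" "P t"
proof (rule ccontr)
  assume "\<not> thesis"
  with that have none: "\<not> P t" if "t \<in> {a<..<b}" for t using that by auto
  have "AE t in lborel. t \<notin> {a<..<b}"
    using assms(1) by eventually_elim (use none in auto)
  then have "emeasure lborel {a<..<b} = 0"
    by (subst (asm) AE_iff_measurable[of "{a<..<b}"]) auto
  then show False using assms(2) by simp
qed

context inner_fixing_0 begin

text \<open>
  Blaschke factors can be split off only finitely often, because each multiplies the modulus at a
  fixed point $z_0$ by at most $\sqrt q < 1$.
\<close>

lemma finite_Blaschke_product_if_bounded_below:
  assumes s: "0 < s" "s < 1" and c: "c > 0"
    and lower: "\<And>z. s < norm z \<Longrightarrow> norm z < 1 \<Longrightarrow> c \<le> norm (f z)"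
  shows "finite_Blaschke_product f"
proof -
  define P where "P N \<longleftrightarrow> (\<exists>\<alpha> h. (\<forall>k<N. norm (\<alpha> k) \<le> s) \<and> h holomorphic_on ball 0 1 \<and>
      (\<forall>z\<in>ball 0 1. norm (h z) \<le> 1) \<and> (\<forall>z\<in>ball 0 1. f z = h z * (\<Prod>k<N. blaschke_factor (\<alpha> k) z)))" for N :: nat
  have P0: "P 0"
    unfolding P_def using hol maps by (intro exI[of _ "\<lambda>_. 0"] exI[of _ f]) (auto intro: less_imp_le)
  \<comment> \<open>A point beyond radius \<open>s\<close>, so that \<open>lower\<close> makes f(z0)
    nonzero.\<close>
  obtain z0 :: complex where z0: "s < norm z0" "norm z0 < 1"
    using s by (intro that[of "of_real ((s + 1) / 2)"]) (simp_all only: norm_of_real, auto)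
  \<comment> \<open>For a zero of modulus at most \<open>s\<close> the denominator in the formula
    for 1 - |.|^2 is at most 4, which makes \<open>q\<close> a common bound for the squared moduli
    of all admissible factors at \<open>z0\<close>.\<close>
  define q where "q = 1 - (1 - s\<^sup>2) * (1 - (norm z0)\<^sup>2) / 4"
  have pos: "0 < 1 - s\<^sup>2" "0 < 1 - (norm z0)\<^sup>2" "1 - s\<^sup>2 \<le> 1" "1 - (norm z0)\<^sup>2 \<le> 1"
    using s z0 by (auto simp: abs_square_less_1)
  have "0 \<le> (1 - s\<^sup>2) * (1 - (norm z0)\<^sup>2)" "(1 - s\<^sup>2) * (1 - (norm z0)\<^sup>2) > 0" "(1 - s\<^sup>2) * (1 - (norm z0)\<^sup>2) \<le> 1"
    using pos by (auto intro!: mult_pos_pos mult_le_one)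
  then have q: "0 < q" "q < 1" by (auto simp: q_def)
  have bf_le: "(norm (blaschke_factor a z0))\<^sup>2 \<le> q" if a: "norm a \<le> s" for a
  proof -
    have a1: "norm a < 1" using a s by simp
    have "norm (cnj a * z0) \<le> 1 * 1"
      unfolding norm_mult complex_mod_cnj using a1 z0 by (intro mult_mono) auto
    then have n2: "norm (1 - cnj a * z0) \<le> 2" using norm_triangle_ineq4[of 1 "cnj a * z0"] by simp
    have "(norm (1 - cnj a * z0))\<^sup>2 \<le> 4" using power_mono[OF n2, of 2] by simp
    moreover have "(norm (1 - cnj a * z0))\<^sup>2 > 0" using one_minus_nonzero[OF a1, of z0] z0 by simp
    moreover have "1 - s\<^sup>2 \<le> 1 - (norm a)\<^sup>2" using a by (simp add: power_mono)
    ultimately have "(1 - s\<^sup>2) * (1 - (norm z0)\<^sup>2) / 4 \<le>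
        (1 - (norm a)\<^sup>2) * (1 - (norm z0)\<^sup>2) / (norm (1 - cnj a * z0))\<^sup>2"
      using pos by (intro frac_le mult_right_mono mult_nonneg_nonneg) auto
    then show ?thesis
      using one_minus_norm_blaschke_factor[OF a1, of z0] z0 unfolding q_def by linarith
  qed
  have fz0: "0 < (norm (f z0))\<^sup>2" using order_less_le_trans[OF c lower[OF z0]] by simp
  obtain n where n: "q ^ n < (norm (f z0))\<^sup>2" using real_arch_pow_inv[OF fz0 q(2)] by blast
  have P_le: "N \<le> n" if "P N" for N
  proof (rule ccontr)
    assume "\<not> N \<le> n"
    obtain \<alpha> h where \<alpha>: "\<And>k. k < N \<Longrightarrow> norm (\<alpha> k) \<le> s" and h: "\<And>z. z \<in> ball 0 1 \<Longrightarrow> norm (h z) \<le> 1"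
      and f_eq: "\<And>z. z \<in> ball 0 1 \<Longrightarrow> f z = h z * (\<Prod>k<N. blaschke_factor (\<alpha> k) z)"
      using \<open>P N\<close> unfolding P_def by blast
    have "(norm (f z0))\<^sup>2 = (norm (h z0))\<^sup>2 * (\<Prod>k<N. (norm (blaschke_factor (\<alpha> k) z0))\<^sup>2)"
      using f_eq[of z0] z0 by (simp add: norm_mult power_mult_distrib prod_norm[symmetric] prod_power_distrib)
    also have "\<dots> \<le> 1 * (\<Prod>k<N. q)"
      using h[of z0] z0 \<alpha> by (intro mult_mono prod_mono conjI bf_le) (auto simp: power_le_one intro: prod_nonneg)
    also have "\<dots> = q ^ N" by simp
    also have "\<dots> \<le> q ^ n" using q \<open>\<not> N \<le> n\<close> by (intro power_decreasing) auto
    finally show False using n by simp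
  qed
  \<comment> \<open>With \<open>N\<close> maximal, a zero of \<open>h\<close> would give one more
    factor; it is also a zero of \<open>f\<close>, hence automatically of modulus at most
    \<open>s\<close>.\<close>
  then obtain N where N: "P N" "\<And>M. P M \<Longrightarrow> M \<le> N"
    using GreatestI_nat[of P 0 n] Greatest_le_nat[of P _ n] P0 P_le by blast
  then obtain \<alpha> h where \<alpha>: "\<And>k. k < N \<Longrightarrow> norm (\<alpha> k) \<le> s" and h: "h holomorphic_on ball 0 1"
    and h_le: "\<And>z. z \<in> ball 0 1 \<Longrightarrow> norm (h z) \<le> 1"
    and f_eq: "\<And>z. z \<in> ball 0 1 \<Longrightarrow> f z = h z * (\<Prod>k<N. blaschke_factor (\<alpha> k) z)"
    unfolding P_def by blast
  have \<alpha>1: "norm (\<alpha> k) < 1" if "k < N" for k using \<alpha>[OF that] s by simp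
  have h_nz: "h a \<noteq> 0" if a: "a \<in> ball 0 1" for a
  proof
    assume "h a = 0"
    moreover from this have "norm a \<le> s" using f_eq[OF a] lower[of a] c a by force
    ultimately obtain g where g: "g holomorphic_on ball 0 1" "\<And>z. z \<in> ball 0 1 \<Longrightarrow> norm (g z) \<le> 1"
      "\<And>z. z \<in> ball 0 1 \<Longrightarrow> h z = blaschke_factor a z * g z"
      using divide_blaschke_factor[OF h h_le, of a] a by (metis mem_ball_0)
    have "f z = g z * (\<Prod>k<Suc N. blaschke_factor ((\<alpha>(N := a)) k) z)" if "z \<in> ball 0 1" for z
    proof -
      have "(\<Prod>k<N. blaschke_factor ((\<alpha>(N := a)) k) z) = (\<Prod>k<N. blaschke_factor (\<alpha> k) z)"
        by (intro prod.cong) auto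
      then show ?thesis using f_eq[OF that] g(3)[OF that] by simp
    qed
    moreover have "\<forall>k<Suc N. norm ((\<alpha>(N := a)) k) \<le> s" using \<alpha> \<open>norm a \<le> s\<close> by (auto simp: less_Suc_eq)
    ultimately have "P (Suc N)" unfolding P_def using g by blast
    then show False using N(2)[of "Suc N"] by simp
  qed
  have f_le_h: "norm (f z) \<le> norm (h z)" if "z \<in> ball 0 1" for z
    unfolding f_eq[OF that] norm_mult
    using norm_blaschke_factor_le_1[OF \<alpha>1] that
    by (intro mult_left_le) (auto simp: prod_norm[symmetric] intro!: prod_le_1)
  \<comment> \<open>Outside radius \<open>s\<close> one has |h| >= |f| >= c, and on the closed disc
    of radius \<open>s\<close> the zero-free \<open>h\<close> has a positive minimum. Modulus 1 at
    an interior point then makes \<open>h\<close> constant.\<close>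
  have "norm (h 0) = 1"
  proof -
    have "cball (0::complex) s \<subseteq> ball 0 1" using s by auto
    then have "continuous_on (cball 0 s) (\<lambda>z. norm (h z))"
      using holomorphic_on_imp_continuous_on[OF h] by (intro continuous_intros) (rule continuous_on_subset)
    then obtain z1 where z1: "z1 \<in> cball 0 s" "\<And>z. z \<in> cball 0 s \<Longrightarrow> norm (h z1) \<le> norm (h z)"
      using continuous_attains_inf[of "cball 0 s" "\<lambda>z. norm (h z)"] s by auto
    show ?thesis
    proof (rule unimodular_at_0[OF h, of "min c (norm (h z1))"])
      show "0 < min c (norm (h z1))" using c h_nz[of z1] z1 s by auto
      show "min c (norm (h z1)) \<le> norm (h z)" if "z \<in> ball 0 1" for z
        using z1(2)[of z] lower[of z] f_le_h[OF that] that by (cases "norm z \<le> s") auto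
      show "AE t in lborel. t \<in> {0..2*pi} \<longrightarrow> ((\<lambda>r. norm (h (of_real r * cis t))) \<longlongrightarrow> 1) (at_left 1)"
        using radial
      proof eventually_elim
        fix t assume t: "t \<in> {0..2*pi} \<longrightarrow> ((\<lambda>r. norm (f (of_real r * cis t))) \<longlongrightarrow> 1) (at_left 1)"
        have ev: "\<forall>\<^sub>F r in at_left 1. of_real r * cis t \<in> ball 0 1"
          using eventually_at_left_real[of 0 1] by (rule eventually_mono) (auto simp: norm_mult)
        have e1: "\<forall>\<^sub>F r in at_left 1. norm (f (of_real r * cis t)) \<le> norm (h (of_real r * cis t))"
          using ev by (rule eventually_mono) (rule f_le_h)
        have e2: "\<forall>\<^sub>F r in at_left 1. norm (h (of_real r * cis t)) \<le> 1"
          using ev by (rule eventually_mono) (rule h_le)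
        show "t \<in> {0..2*pi} \<longrightarrow> ((\<lambda>r. norm (h (of_real r * cis t))) \<longlongrightarrow> 1) (at_left 1)"
          using tendsto_sandwich[OF e1 e2 _ tendsto_const] t by blast
      qed
    qed (use h_le in auto)
  qed
  then have "h constant_on ball 0 1"
    by (intro maximum_modulus_principle[OF h, of "ball 0 1" 0]) (use h_le in auto)
  then have h_const: "h z = h 0" if "z \<in> ball 0 1" for z
    using that by (metis constant_on_def centre_in_ball zero_less_one)
  have "\<forall>z\<in>ball 0 1. f z = h 0 * (\<Prod>k<N. (z - \<alpha> k) / (1 - cnj (\<alpha> k) * z))"
    using f_eq unfolding blaschke_factor_def by (metis h_const)
  then show ?thesis
    unfolding finite_Blaschke_product_def using \<open>norm (h 0) = 1\<close> \<alpha>1 by blast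
qed

text \<open>The exceptional angles form a null set and so contain no interval; good radii therefore
  end arbitrarily close to \<xi>. Only angles to the right of \<open>t0\<close> are tried, which
  stay in the admissible range because \<open>t0\<close> is below 2 pi.\<close>

lemma radial_point_near:
  assumes \<xi>: "norm \<xi> = 1" and e: "e > 0" and \<rho>: "\<rho> < 1"
  obtains z where "z \<in> ball 0 1" "z \<in> ball \<xi> e" "\<rho> < norm (f z)"
proof -
  define t0 where "t0 = Arg2pi \<xi>"
  have t0: "0 \<le> t0" "t0 < 2*pi" "\<xi> = cis t0"
    using Arg2pi[of \<xi>] \<xi> by (auto simp: t0_def cis_conv_exp is_Arg_def)
  have "continuous_on UNIV (\<lambda>t. cis t)" by (rule continuous_on_cis[OF continuous_on_id])
  then have "isCont cis t0" by (simp add: continuous_on_eq_continuous_at)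
  then have "(cis \<longlongrightarrow> cis t0) (at_right t0)"
    unfolding isCont_def by (rule tendsto_within_subset) auto
  then have "\<forall>\<^sub>F t in at_right t0. cis t \<in> ball \<xi> e"
    by (rule topological_tendstoD) (use e t0 in auto)
  then obtain d where d: "d > t0" "\<And>t. t0 < t \<Longrightarrow> t < d \<Longrightarrow> cis t \<in> ball \<xi> e"
    unfolding eventually_at_right_field by blast
  obtain t where t: "t0 < t" "t < min d (2*pi)" "t \<in> {0..2*pi} \<longrightarrow> ((\<lambda>r. norm (f (of_real r * cis t))) \<longlongrightarrow> 1) (at_left 1)"
    using AE_lborel_obtain[OF radial, of t0 "min d (2*pi)"] d t0 by (metis min_less_iff_conj)
  then have "((\<lambda>r. norm (f (of_real r * cis t))) \<longlongrightarrow> 1) (at_left 1)" using t0 by auto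
  then have 1: "\<forall>\<^sub>F r in at_left 1. \<rho> < norm (f (of_real r * cis t))"
    using \<rho> by (rule order_tendstoD)
  have "((\<lambda>r. of_real r * cis t) \<longlongrightarrow> of_real 1 * cis t) (at_left 1)"
    by (intro tendsto_intros)
  then have 2: "\<forall>\<^sub>F r in at_left 1. of_real r * cis t \<in> ball \<xi> e"
    by (rule topological_tendstoD) (use d(2)[of t] t in auto)
  have 3: "\<forall>\<^sub>F r in at_left 1. of_real r * cis t \<in> ball 0 1"
    using eventually_at_left_real[of 0 1] by (rule eventually_mono) (auto simp: norm_mult)
  have "\<exists>r. of_real r * cis t \<in> ball 0 1 \<and> of_real r * cis t \<in> ball \<xi> e \<and> \<rho> < norm (f (of_real r * cis t))"
    using eventually_happens'[OF trivial_limit_at_left_real eventually_conj[OF 3 eventually_conj[OF 2 1]]] by blast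
  then show thesis using that by blast
qed

text \<open>
  At a boundary point $\xi$ which is a limit of points where $|f| < 1/2$, the cluster set of $f$ contains
  points of every modulus between $1/2$ and $1$, as $|f|$ also gets close to $1$ near $\xi$. The sum is
  $G \circ f$ with $G$ holomorphic, and $G$ takes the value of the sum at $\xi$ on the whole cluster set.
\<close>

lemma finite_Blaschke_product_if_disc_algebra:
  assumes nr: "\<not> rotation f" and nz: "\<exists>n\<ge>1. a n \<noteq> 0"
    and lim: "locally_uniform_limit (iter_sum a) F"
    and H: "continuous_on (cball 0 1) H" "\<And>z. z \<in> ball 0 1 \<Longrightarrow> H z = F z"
  shows "finite_Blaschke_product f"
proof (rule ccontr)
  assume notB: "\<not> finite_Blaschke_product f"
  \<comment> \<open>A lower bound 1/2 on an annulus next to the circle would already make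
    \<open>f\<close> a finite Blaschke product.\<close>
  have "\<exists>z. 1 - 1 / (real k + 2) < norm z \<and> norm z < 1 \<and> norm (f z) < 1/2" for k
    using finite_Blaschke_product_if_bounded_below[of "1 - 1 / (real k + 2)" "1/2"] notB
    by (force simp: field_simps not_le)
  then obtain zs where zs: "\<And>k. 1 - 1 / (real k + 2) < norm (zs k)" "\<And>k. norm (zs k) < 1" "\<And>k. norm (f (zs k)) < 1/2"
    by metis
  have "zs k \<in> cball 0 1" for k using zs(2)[of k] by simp
  then obtain \<xi> and r :: "nat \<Rightarrow> nat" where r: "strict_mono r" "(zs \<circ> r) \<longlonglongrightarrow> \<xi>"
    using compact_cball[of "0::complex" 1] unfolding compact_def by metis
  have "(\<lambda>k. norm (zs k)) \<longlonglongrightarrow> 1"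
  proof (rule tendsto_sandwich)
    show "(\<lambda>k. 1 - 1 / (real k + 2)) \<longlonglongrightarrow> 1" by real_asymp
  qed (use zs in \<open>auto intro!: always_eventually less_imp_le\<close>)
  then have "((\<lambda>k. norm (zs k)) \<circ> r) \<longlonglongrightarrow> 1" using LIMSEQ_subseq_LIMSEQ r(1) by blast
  then have \<xi>: "norm \<xi> = 1" using tendsto_norm[OF r(2)] LIMSEQ_unique by (fastforce simp: o_def)
  obtain h where h: "h holomorphic_on ball 0 1" "\<And>z. z \<in> ball 0 1 \<Longrightarrow> F z = a 1 * f z + h (f z)"
    using iter_sum_shift[OF lim] by metis
  define G where "G w = a 1 * w + h w - H \<xi>" for w
  have G: "G holomorphic_on ball 0 1" unfolding G_def by (intro holomorphic_intros h)
  have G_f: "G (f z) = H z - H \<xi>" if "z \<in> ball 0 1" for z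
    using h(2)[OF that] H(2)[OF that] by (simp add: G_def)
  have cluster: "\<exists>w. norm w = \<rho> \<and> G w = 0" if \<rho>: "1/2 < \<rho>" "\<rho> < 1" for \<rho>
  proof -
    have "\<exists>z. z \<in> ball 0 1 \<and> z \<in> ball \<xi> (1 / (real n + 1)) \<and> norm (f z) = \<rho>" for n
    proof -
      define B where "B = ball 0 1 \<inter> ball \<xi> (1 / (real n + 1))"
      \<comment> \<open>An intersection of discs is convex, so |f| takes there every value between
        one below 1/2 and one above \<rho>.\<close>
      have "connected ((\<lambda>z. norm (f z)) ` B)"
        unfolding B_def using holomorphic_on_imp_continuous_on[OF hol]
        by (intro connected_continuous_image continuous_intros convex_connected convex_Int)
           (auto intro: continuous_on_subset)
      moreover obtain k where k: "zs (r k) \<in> ball \<xi> (1 / (real n + 1))"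
        using r(2) unfolding lim_sequentially o_def
        by (metis mem_ball dist_commute zero_less_divide_1_iff of_nat_0_less_iff zero_less_Suc of_nat_Suc add.commute order_refl)
      then have "norm (f (zs (r k))) \<in> (\<lambda>z. norm (f z)) ` B" using zs(2)[of "r k"] by (auto simp: B_def)
      moreover obtain z where "z \<in> B" "\<rho> < norm (f z)"
        using radial_point_near[OF \<xi>, of "1 / (real n + 1)" \<rho>] \<rho> unfolding B_def by (auto simp: add_pos_nonneg)
      ultimately have "\<rho> \<in> (\<lambda>z. norm (f z)) ` B"
        using connectedD_interval[of _ "norm (f (zs (r k)))" "norm (f z)" \<rho>] zs(3)[of "r k"] \<rho> by fastforce
      then show ?thesis unfolding B_def by blast
    qed
    then obtain y where y: "\<And>n. y n \<in> ball 0 1" "\<And>n. y n \<in> ball \<xi> (1 / (real n + 1))" "\<And>n. norm (f (y n)) = \<rho>"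
      by metis
    have "\<forall>n. f (y n) \<in> sphere 0 \<rho>" using y by simp
    then obtain w and q :: "nat \<Rightarrow> nat" where q: "w \<in> sphere 0 \<rho>" "strict_mono q" "((\<lambda>n. f (y n)) \<circ> q) \<longlonglongrightarrow> w"
      using compact_sphere[of "0::complex" \<rho>] unfolding compact_def by metis
    have "y \<longlonglongrightarrow> \<xi>"
    proof (rule metric_LIMSEQ_I)
      fix e :: real assume "e > 0"
      then obtain N where N: "1 / (real N + 1) < e"
        by (metis nat_approx_posE of_nat_Suc add.commute)
      have "dist (y n) \<xi> < e" if "n \<ge> N" for n
      proof -
        have "1 / (real n + 1) \<le> 1 / (real N + 1)" using that by (intro divide_left_mono) auto
        then show ?thesis using y(2)[of n] N by (simp add: dist_commute)
      qed
      then show "\<exists>no. \<forall>n\<ge>no. dist (y n) \<xi> < e" by blast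
    qed
    then have "(\<lambda>n. H (y n)) \<longlonglongrightarrow> H \<xi>"
      using H(1) \<xi> y(1) unfolding continuous_on_sequentially o_def
      by (metis mem_cball_0 mem_ball_0 less_imp_le order_refl)
    then have "(\<lambda>n. G (f (y n))) \<longlonglongrightarrow> 0" using y(1) by (simp add: G_f LIM_zero)
    then have "(\<lambda>n. G (f (y (q n)))) \<longlonglongrightarrow> 0" using LIMSEQ_subseq_LIMSEQ[OF _ q(2)] by (fastforce simp: o_def)
    moreover have "isCont G w"
      using holomorphic_on_imp_continuous_on[OF G] q(1) \<rho> by (simp add: continuous_on_eq_continuous_at)
    then have "(\<lambda>n. G (f (y (q n)))) \<longlonglongrightarrow> G w"
      using q(3) unfolding o_def by (rule isCont_tendsto_compose)
    ultimately have "G w = 0" using LIMSEQ_unique by blast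
    then show ?thesis using q(1) by auto
  qed
  \<comment> \<open>One zero of \<open>G\<close> for every modulus in an interval gives infinitely
    many zeros, and the cap 3/4 keeps their limit point inside the disc.\<close>
  define W where "W = {w. norm w \<in> {1/2<..<3/4} \<and> G w = 0}"
  have "{1/2<..<3/4} \<subseteq> norm ` W"
  proof
    fix \<rho> :: real assume "\<rho> \<in> {1/2<..<3/4}"
    then obtain w where "norm w = \<rho>" "G w = 0" using cluster[of \<rho>] by auto
    then show "\<rho> \<in> norm ` W" using \<open>\<rho> \<in> _\<close> by (auto simp: W_def)
  qed
  moreover have "infinite {1/2<..<3/4::real}" by (rule infinite_Ioo) simp
  ultimately have "infinite W" using finite_subset finite_imageI by metis
  moreover have W_sub: "W \<subseteq> cball 0 (3/4)" by (auto simp: W_def)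
  ultimately obtain p where p: "p \<in> cball 0 (3/4)" "p islimpt W"
    using compact_eq_Bolzano_Weierstrass[of "cball (0::complex) (3/4)"] by auto
  have G0: "G w = 0" if "w \<in> ball 0 1" for w
    by (rule analytic_continuation[OF G _ _ _ _ p(2) _ that]) (use p(1) in \<open>auto simp: W_def\<close>)
  \<comment> \<open>The sum is constant, and the constant is 0 because all iterates fix the
    origin.\<close>
  have F_const: "F z = H \<xi>" if "z \<in> ball 0 1" for z
    using G_f[OF that] G0[OF maps[OF that]] H(2)[OF that] by simp
  have "(f ^^ n) 0 = 0" for n by (induction n) auto
  then have "iter_sum a N 0 = 0" for N by (simp add: iter_sum_def)
  then have "F 0 = 0" using locally_uniform_limit_LIMSEQ[OF lim, of 0] by (simp add: LIMSEQ_const_iff)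
  then have "F z = 0" if "z \<in> ball 0 1" for z using F_const[OF that] F_const[of 0] by simp
  then have "locally_uniform_limit (iter_sum a) (\<lambda>z. 0)" by (intro locally_uniform_limit_cong[OF lim]) auto
  then have "a (Suc n) = 0" for n by (rule iter_sum_limit_zero[OF nr])
  then show False using nz by (metis Suc_le_D One_nat_def)
qed

end

section \<open>Means over the unit circle\<close>

definition circle_mean :: "(complex \<Rightarrow> complex) \<Rightarrow> complex" where
  "circle_mean h = integral {0..2*pi} (\<lambda>t. h (cis t)) / (2 * pi)"

lemma circle_integrable:
  fixes h :: "complex \<Rightarrow> 'a::banach"
  assumes "continuous_on (sphere 0 1) h"
  shows "(\<lambda>t. h (cis t)) integrable_on {0..2*pi}"
  by (intro integrable_continuous_interval continuous_on_compose2[OF assms] continuous_on_cis continuous_on_id) auto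

lemma circle_mean_cong: "(\<And>z. norm z = 1 \<Longrightarrow> g z = h z) \<Longrightarrow> circle_mean g = circle_mean h"
  by (simp add: circle_mean_def)

lemma circle_mean_add:
  "continuous_on (sphere 0 1) g \<Longrightarrow> continuous_on (sphere 0 1) h \<Longrightarrow>
    circle_mean (\<lambda>z. g z + h z) = circle_mean g + circle_mean h"
  by (simp add: circle_mean_def integral_add circle_integrable add_divide_distrib)

lemma circle_mean_diff:
  "continuous_on (sphere 0 1) g \<Longrightarrow> continuous_on (sphere 0 1) h \<Longrightarrow>
    circle_mean (\<lambda>z. g z - h z) = circle_mean g - circle_mean h"
  by (simp add: circle_mean_def integral_diff circle_integrable diff_divide_distrib)

lemma circle_mean_cmult: "circle_mean (\<lambda>z. c * h z) = c * circle_mean h"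
  by (simp add: circle_mean_def)

lemma circle_mean_sum:
  "finite I \<Longrightarrow> (\<And>i. i \<in> I \<Longrightarrow> continuous_on (sphere 0 1) (g i)) \<Longrightarrow>
    circle_mean (\<lambda>z. \<Sum>i\<in>I. g i z) = (\<Sum>i\<in>I. circle_mean (g i))"
  by (simp add: circle_mean_def integral_sum circle_integrable sum_divide_distrib)

lemma circle_mean_cnj: "circle_mean (\<lambda>z. cnj (h z)) = cnj (circle_mean h)"
  by (simp add: circle_mean_def integral_cnj)

lemma circle_mean_holomorphic:
  assumes "continuous_on (cball 0 1) h" "h holomorphic_on ball 0 1"
  shows "circle_mean h = h 0"
  using integral_unique[OF has_integral_circle_mean[of 1 h]] assms by (simp add: circle_mean_def)

lemma circle_mean_const: "circle_mean (\<lambda>z. c) = c"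
  by (simp add: circle_mean_holomorphic)

text \<open>Cauchy's formula for the k-th derivative, with dz / z^(k+1) = \<i> dt / z^k on the
  circle: negative moments read off Taylor coefficients.\<close>

lemma circle_mean_divide_power:
  assumes "continuous_on (cball 0 1) h" "h holomorphic_on ball 0 1"
  shows "circle_mean (\<lambda>z. h z / z ^ k) = (deriv ^^ k) h 0 / fact k"
proof -
  have "((\<lambda>u. h u / (u - 0) ^ Suc k) has_contour_integral ((2 * pi * \<i>) / (fact k) * (deriv ^^ k) h 0)) (circlepath 0 1)"
    by (rule Cauchy_has_contour_integral_higher_derivative_circlepath[OF assms]) simp
  then have "((\<lambda>t. h (0 + of_real 1 * cis t) / (0 + of_real 1 * cis t - 0) ^ Suc k * of_real 1 * \<i> * cis t)
      has_integral ((2 * pi * \<i>) / (fact k) * (deriv ^^ k) h 0)) {0..2*pi}"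
    unfolding circlepath_def by (subst (asm) has_contour_integral_part_circlepath_iff) auto
  then have "((\<lambda>t. \<i> * (h (cis t) / cis t ^ k)) has_integral ((2 * pi * \<i>) / (fact k) * (deriv ^^ k) h 0)) {0..2*pi}"
    by (rule has_integral_eq[rotated]) (auto simp: field_simps)
  then have "\<i> * integral {0..2*pi} (\<lambda>t. h (cis t) / cis t ^ k) = (2 * pi * \<i>) / (fact k) * (deriv ^^ k) h 0"
    by (metis integral_unique integral_mult_right)
  then show ?thesis by (simp add: circle_mean_def field_simps)
qed

text \<open>Meant for u = v * P with a nonnegative density \<open>P\<close> and |v| <= M; the bound
  is \<open>M\<close> times the total mass.\<close>

lemma norm_circle_mean_le:
  assumes u: "continuous_on (sphere 0 1) u" and P: "continuous_on (sphere 0 1) P"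
    and le: "\<And>z. norm z = 1 \<Longrightarrow> norm (u z) \<le> M * P z"
  shows "norm (circle_mean u) \<le> M * Re (circle_mean (\<lambda>z. of_real (P z)))"
proof -
  have P': "continuous_on (sphere 0 1) (\<lambda>z. complex_of_real (P z))"
    by (intro continuous_intros P)
  have Re_eq: "Re (circle_mean (\<lambda>z. of_real (P z))) = integral {0..2*pi} (\<lambda>t. P (cis t)) / (2 * pi)"
    using integral_linear[OF circle_integrable[OF P'] bounded_linear_Re]
    by (simp add: circle_mean_def o_def)
  have "norm (integral {0..2*pi} (\<lambda>t. u (cis t))) \<le> integral {0..2*pi} (\<lambda>t. M * P (cis t))"
    by (intro integral_norm_bound_integral circle_integrable[OF u] integrable_on_mult_right circle_integrable[OF P] le) simp
  then show ?thesis
    unfolding Re_eq by (simp add: circle_mean_def norm_divide field_simps)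
qed

lemma norm_circle_mean_bound:
  assumes "continuous_on (sphere 0 1) u" "\<And>z. norm z = 1 \<Longrightarrow> norm (u z) \<le> M"
  shows "norm (circle_mean u) \<le> M"
  using norm_circle_mean_le[OF assms(1), of "\<lambda>_. 1" M] assms(2) by (simp add: circle_mean_const)

text \<open>These are the trigonometric polynomials. Only values on the circle count, so conjugation
  can be replaced by inversion.\<close>

definition laurent_poly_on_circle :: "(complex \<Rightarrow> complex) \<Rightarrow> bool" where
  "laurent_poly_on_circle h \<longleftrightarrow> (\<exists>p n. \<forall>z. norm z = 1 \<longrightarrow> h z = poly p z / z ^ n)"

lemma laurent_poly_const: "laurent_poly_on_circle (\<lambda>z. c)"
  unfolding laurent_poly_on_circle_def by (intro exI[of _ "[:c:]"] exI[of _ 0]) simp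

lemma laurent_poly_add:
  assumes "laurent_poly_on_circle g" "laurent_poly_on_circle h"
  shows "laurent_poly_on_circle (\<lambda>z. g z + h z)"
proof -
  obtain p n q m where "\<And>z. norm z = 1 \<Longrightarrow> g z = poly p z / z ^ n" "\<And>z. norm z = 1 \<Longrightarrow> h z = poly q z / z ^ m"
    using assms unfolding laurent_poly_on_circle_def by blast
  moreover have "z \<noteq> 0" if "norm z = 1" for z :: complex using that by auto
  ultimately have "\<forall>z. norm z = 1 \<longrightarrow> g z + h z = poly (p * monom 1 m + q * monom 1 n) z / z ^ (n + m)"
    by (simp add: poly_monom power_add add_divide_distrib)
  then show ?thesis unfolding laurent_poly_on_circle_def by blast
qed

lemma laurent_poly_mult:
  assumes "laurent_poly_on_circle g" "laurent_poly_on_circle h"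
  shows "laurent_poly_on_circle (\<lambda>z. g z * h z)"
proof -
  obtain p n q m where "\<And>z. norm z = 1 \<Longrightarrow> g z = poly p z / z ^ n" "\<And>z. norm z = 1 \<Longrightarrow> h z = poly q z / z ^ m"
    using assms unfolding laurent_poly_on_circle_def by blast
  then have "\<forall>z. norm z = 1 \<longrightarrow> g z * h z = poly (p * q) z / z ^ (n + m)"
    by (auto simp: power_add)
  then show ?thesis unfolding laurent_poly_on_circle_def by blast
qed

lemma cnj_eq_inverse: "norm z = 1 \<Longrightarrow> cnj z = 1 / (z::complex)"
  by (metis complex_norm_square divide_self_if mult.commute nonzero_eq_divide_eq norm_zero of_real_1 power_one zero_neq_one)

lemma laurent_poly_Re_Im:
  "laurent_poly_on_circle (\<lambda>z. of_real (Re z))" "laurent_poly_on_circle (\<lambda>z. of_real (Im z))"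
proof -
  have "\<forall>z. norm z = 1 \<longrightarrow> of_real (Re z) = poly [:1/2, 0, 1/2:] z / z ^ 1"
  proof safe
    fix z :: complex assume z: "norm z = 1"
    have "z \<noteq> 0" using z by auto
    have "of_real (Re z) = (z + cnj z) / 2" by (simp add: complex_add_cnj)
    also have "\<dots> = poly [:1/2, 0, 1/2:] z / z ^ 1"
      unfolding cnj_eq_inverse[OF z] using \<open>z \<noteq> 0\<close> by (simp add: field_simps)
    finally show "of_real (Re z) = poly [:1/2, 0, 1/2:] z / z ^ 1" .
  qed
  then show "laurent_poly_on_circle (\<lambda>z. of_real (Re z))" unfolding laurent_poly_on_circle_def by blast
  have "\<forall>z. norm z = 1 \<longrightarrow> of_real (Im z) = poly [:\<i>/2, 0, -\<i>/2:] z / z ^ 1"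
  proof safe
    fix z :: complex assume z: "norm z = 1"
    have "z \<noteq> 0" using z by auto
    have "of_real (Im z) = - \<i> * (z - cnj z) / 2" by (simp add: complex_eq_iff)
    also have "\<dots> = poly [:\<i>/2, 0, -\<i>/2:] z / z ^ 1"
      unfolding cnj_eq_inverse[OF z] using \<open>z \<noteq> 0\<close> by (simp add: field_simps)
    finally show "of_real (Im z) = poly [:\<i>/2, 0, -\<i>/2:] z / z ^ 1" .
  qed
  then show "laurent_poly_on_circle (\<lambda>z. of_real (Im z))" unfolding laurent_poly_on_circle_def by blast
qed

lemma laurent_poly_real_polynomial_function:
  "real_polynomial_function p \<Longrightarrow> laurent_poly_on_circle (\<lambda>z. of_real (p z))" for p :: "complex \<Rightarrow> real"
proof (induction rule: real_polynomial_function.induct)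
  case (linear p)
  then interpret bounded_linear p .
  have p_eq: "p z = Re z * p 1 + Im z * p \<i>" for z
  proof -
    have "z = Re z *\<^sub>R 1 + Im z *\<^sub>R \<i>" by (simp add: complex_eq_iff)
    then have "p z = p (Re z *\<^sub>R 1 + Im z *\<^sub>R \<i>)" by simp
    also have "\<dots> = Re z * p 1 + Im z * p \<i>" unfolding add scaleR by simp
    finally show ?thesis .
  qed
  have "(\<lambda>z. complex_of_real (p z)) =
      (\<lambda>z. of_real (Re z) * of_real (p 1) + of_real (Im z) * of_real (p \<i>))"
    by (rule ext) (subst p_eq, simp)
  then show ?case
    by (simp only:) (intro laurent_poly_add laurent_poly_mult laurent_poly_Re_Im laurent_poly_const)
qed (simp_all add: laurent_poly_const laurent_poly_add laurent_poly_mult)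

text \<open>Stone-Weierstrass gives real polynomials in Re z and Im z, and on the circle both of
  these are Laurent polynomials.\<close>

lemma laurent_poly_dense:
  fixes h :: "complex \<Rightarrow> complex"
  assumes h: "continuous_on (sphere 0 1) h" and "e > 0"
  obtains p n where "\<And>z. norm z = 1 \<Longrightarrow> norm (h z - poly p z / z ^ n) < e"
proof -
  obtain g where g: "polynomial_function g" "\<And>z. z \<in> sphere 0 1 \<Longrightarrow> norm (h z - g z) < e"
    using Stone_Weierstrass_polynomial_function[OF compact_sphere[of 0 1] h \<open>e > 0\<close>] by blast
  have "real_polynomial_function (Re \<circ> g)" "real_polynomial_function (Im \<circ> g)"
    using g(1) bounded_linear_Re bounded_linear_Im unfolding polynomial_function_def by auto
  from this[THEN laurent_poly_real_polynomial_function]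
  have "laurent_poly_on_circle (\<lambda>z. of_real ((Re \<circ> g) z) + \<i> * of_real ((Im \<circ> g) z))"
    by (intro laurent_poly_add laurent_poly_mult laurent_poly_const)
  then have "laurent_poly_on_circle g" by (simp flip: complex_eq)
  then obtain p n where "\<And>z. norm z = 1 \<Longrightarrow> g z = poly p z / z ^ n"
    unfolding laurent_poly_on_circle_def by blast
  then show thesis using that g(2) by auto
qed

lemma laurent_term_cases:
  fixes z :: complex
  assumes "z \<noteq> 0"
  shows "z ^ i / z ^ n = (if n \<le> i then z ^ (i - n) else 1 / z ^ (n - i))"
  using assms by (simp add: power_diff)

lemma circle_mean_laurent:
  assumes w: "continuous_on (sphere 0 1) w" and B: "continuous_on (sphere 0 1) B" "\<And>z. norm z = 1 \<Longrightarrow> norm (B z) = 1"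
  shows "circle_mean (\<lambda>z. w z * (poly p (B z) / B z ^ n)) =
    (\<Sum>i\<le>degree p. coeff p i * circle_mean (\<lambda>z. w z * (if n \<le> i then B z ^ (i - n) else 1 / B z ^ (n - i))))"
proof -
  have nz: "B z \<noteq> 0" if "norm z = 1" for z using B(2)[OF that] by auto
  have "circle_mean (\<lambda>z. w z * (poly p (B z) / B z ^ n)) =
      circle_mean (\<lambda>z. \<Sum>i\<le>degree p. coeff p i * (w z * (B z ^ i / B z ^ n)))"
    by (rule circle_mean_cong) (simp add: poly_altdef sum_divide_distrib sum_distrib_left mult_ac)
  also have "\<dots> = (\<Sum>i\<le>degree p. circle_mean (\<lambda>z. coeff p i * (w z * (B z ^ i / B z ^ n))))"
    using nz by (intro circle_mean_sum continuous_intros w B) auto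
  also have "\<dots> = (\<Sum>i\<le>degree p. coeff p i * circle_mean (\<lambda>z. w z * (if n \<le> i then B z ^ (i - n) else 1 / B z ^ (n - i))))"
    unfolding circle_mean_cmult using nz by (intro sum.cong arg_cong2[of _ _ _ _ "(*)"] circle_mean_cong) (simp_all add: laurent_term_cases)
  finally show ?thesis .
qed

text \<open>The conclusion says that the adjoint of composition with \<open>B\<close> sends
  \<open>w\<close> to \<open>v\<close>. By density of the Laurent polynomials it suffices to compare
  moments of all positive and negative orders.\<close>

lemma circle_mean_compose_eqI:
  assumes w: "continuous_on (sphere 0 1) w" and v: "continuous_on (sphere 0 1) v"
    and B: "continuous_on (sphere 0 1) B" "\<And>z. norm z = 1 \<Longrightarrow> norm (B z) = 1"
    and pos: "\<And>k. circle_mean (\<lambda>z. w z * B z ^ k) = circle_mean (\<lambda>z. v z * z ^ k)"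
    and neg: "\<And>k. k > 0 \<Longrightarrow> circle_mean (\<lambda>z. w z * (1 / B z ^ k)) = circle_mean (\<lambda>z. v z * (1 / z ^ k))"
    and h: "continuous_on (sphere 0 1) h"
  shows "circle_mean (\<lambda>z. w z * h (B z)) = circle_mean (\<lambda>z. v z * h z)"
proof -
  have "bounded (w ` sphere 0 1)" "bounded (v ` sphere 0 1)"
    by (intro compact_imp_bounded compact_continuous_image compact_sphere w v)+
  then obtain C1 C2 where C: "\<And>z. norm z = 1 \<Longrightarrow> norm (w z) \<le> C1" "\<And>z. norm z = 1 \<Longrightarrow> norm (v z) \<le> C2"
    unfolding bounded_iff by fastforce
  have C_nonneg: "0 \<le> C1" "0 \<le> C2" 
    using order_trans[OF norm_ge_zero C(1)[of 1]] order_trans[OF norm_ge_zero C(2)[of 1]] by simp_all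
  have hB: "continuous_on (sphere 0 1) (\<lambda>z. h (B z))"
    using B by (intro continuous_on_compose2[OF h B(1)]) auto
  have "norm (circle_mean (\<lambda>z. w z * h (B z)) - circle_mean (\<lambda>z. v z * h z)) \<le> 0 + e" if "e > 0" for e
  proof -
    define d where "d = e / (C1 + C2 + 1)"
    have "d > 0" using \<open>e > 0\<close> C_nonneg by (simp add: d_def)
    obtain p n where p: "\<And>z. norm z = 1 \<Longrightarrow> norm (h z - poly p z / z ^ n) < d"
      using laurent_poly_dense[OF h \<open>d > 0\<close>] by blast
    define q where "q z = poly p z / z ^ n" for z
    have q: "continuous_on (sphere 0 1) q"
      unfolding q_def by (intro continuous_intros) auto
    have qB: "continuous_on (sphere 0 1) (\<lambda>z. q (B z))"
      using B by (intro continuous_on_compose2[OF q B(1)]) auto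
    have term_eq: "circle_mean (\<lambda>z. w z * (if n \<le> i then B z ^ (i - n) else 1 / B z ^ (n - i))) =
        circle_mean (\<lambda>z. v z * (if n \<le> i then z ^ (i - n) else 1 / z ^ (n - i)))" for i
      using pos[of "i - n"] neg[of "n - i"] by (cases "n \<le> i") auto
    have eq: "circle_mean (\<lambda>z. w z * q (B z)) = circle_mean (\<lambda>z. v z * q z)"
      using circle_mean_laurent[OF w B, of p n] circle_mean_laurent[OF v continuous_on_id, of p n]
      unfolding q_def term_eq by (simp only: id_apply)
    have "circle_mean (\<lambda>z. w z * h (B z)) - circle_mean (\<lambda>z. v z * h z)
        = circle_mean (\<lambda>z. w z * (h (B z) - q (B z))) - circle_mean (\<lambda>z. v z * (h z - q z))"
      by (simp add: right_diff_distrib circle_mean_diff continuous_on_mult w v hB qB h q eq)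
    also have "norm \<dots> \<le> norm (circle_mean (\<lambda>z. w z * (h (B z) - q (B z)))) + norm (circle_mean (\<lambda>z. v z * (h z - q z)))"
      by (rule norm_triangle_ineq4)
    also have "\<dots> \<le> C1 * d + C2 * d"
    proof (rule add_mono; rule norm_circle_mean_bound)
      show "continuous_on (sphere 0 1) (\<lambda>z. w z * (h (B z) - q (B z)))"
        "continuous_on (sphere 0 1) (\<lambda>z. v z * (h z - q z))"
        by (intro continuous_on_mult continuous_on_diff w v hB qB h q)+
      fix z :: complex assume z: "norm z = 1"
      show "norm (w z * (h (B z) - q (B z))) \<le> C1 * d" "norm (v z * (h z - q z)) \<le> C2 * d"
        unfolding norm_mult q_def
        using p[OF z] p[OF B(2)[OF z]] C(1)[OF z] C(2)[OF z] C_nonneg by (intro mult_mono; simp)+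
    qed
    also have "\<dots> \<le> (C1 + C2 + 1) * d"
      using \<open>d > 0\<close> by (simp add: distrib_right)
    also have "\<dots> = e"
      using C_nonneg by (simp add: d_def)
    finally show ?thesis by simp
  qed
  then have "norm (circle_mean (\<lambda>z. w z * h (B z)) - circle_mean (\<lambda>z. v z * h z)) \<le> 0"
    by (rule field_le_epsilon)
  then show ?thesis by simp
qed

text \<open>Weak convergence of boundary values: smallness near 0 forces every Taylor coefficient to
  0, which settles Laurent polynomials \<open>P\<close>, and the uniform bound \<open>C\<close>
  extends this to continuous \<open>P\<close> by density.\<close>

lemma circle_mean_tendsto_0:
  assumes u: "\<And>j. continuous_on (cball 0 1) (u j)" "\<And>j. u j holomorphic_on ball 0 1"
    and bound: "\<And>j z. z \<in> cball 0 1 \<Longrightarrow> norm (u j z) \<le> C"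
    and small: "\<And>e. e > 0 \<Longrightarrow> \<forall>\<^sub>F j in sequentially. \<forall>z\<in>cball 0 (1/2). norm (u j z) \<le> e"
    and P: "continuous_on (sphere 0 1) P"
  shows "(\<lambda>j. circle_mean (\<lambda>z. u j z * P z)) \<longlonglongrightarrow> 0"
proof -
  have us: "continuous_on (sphere 0 1) (u j)" for j
    using u(1) by (rule continuous_on_subset) auto
  have C: "C \<ge> 0" using order_trans[OF norm_ge_zero bound[of 0 0]] by simp
  have pos: "(\<lambda>j. circle_mean (\<lambda>z. u j z * z ^ k)) \<longlonglongrightarrow> 0" for k
  proof -
    have eq: "circle_mean (\<lambda>z. u j z * z ^ k) = u j 0 * 0 ^ k" for j
      by (intro circle_mean_holomorphic[of "\<lambda>z. u j z * z ^ k"] continuous_intros holomorphic_intros u)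
    have "(\<lambda>j. u j 0) \<longlonglongrightarrow> 0"
      unfolding tendsto_iff dist_norm
    proof safe
      fix e :: real assume "e > 0"
      then have "\<forall>\<^sub>F j in sequentially. \<forall>z\<in>cball 0 (1/2). norm (u j z) \<le> e / 2" by (intro small) simp
      then show "\<forall>\<^sub>F j in sequentially. norm (u j 0 - 0) < e"
      proof (rule eventually_mono)
        fix j assume "\<forall>z\<in>cball 0 (1/2). norm (u j z) \<le> e / 2"
        then have "norm (u j 0) \<le> e / 2" by simp
        then show "norm (u j 0 - 0) < e" using \<open>e > 0\<close> by simp
      qed
    qed
    then show ?thesis unfolding eq by (rule tendsto_mult_left_zero)
  qed
  have neg: "(\<lambda>j. circle_mean (\<lambda>z. u j z * (1 / z ^ k))) \<longlonglongrightarrow> 0" for k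
    unfolding tendsto_iff dist_norm
  proof safe
    fix e :: real assume "e > 0"
    \<comment> \<open>Cauchy's inequality on the disc of radius 1/2 loses the factor 2^k, which the
      tolerance absorbs.\<close>
    then have "\<forall>\<^sub>F j in sequentially. \<forall>z\<in>cball 0 (1/2). norm (u j z) \<le> e / 2 / 2 ^ k" by (intro small) simp
    then show "\<forall>\<^sub>F j in sequentially. norm (circle_mean (\<lambda>z. u j z * (1 / z ^ k)) - 0) < e"
    proof eventually_elim
      case (elim j)
      have sub: "cball 0 (1/2) \<subseteq> cball (0::complex) 1" "ball 0 (1/2) \<subseteq> ball (0::complex) 1" by auto
      have "norm ((deriv ^^ k) (u j) 0) \<le> fact k * (e / 2 / 2 ^ k) / (1/2) ^ k"
        using elim
        by (intro Cauchy_inequality holomorphic_on_subset[OF u(2) sub(2)] continuous_on_subset[OF u(1) sub(1)]) auto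
      then have "norm ((deriv ^^ k) (u j) 0 / fact k) \<le> e / 2"
        by (simp add: norm_divide field_simps power_divide)
      then show ?case
        using circle_mean_divide_power[OF u(1)[of j] u(2)[of j], of k] \<open>e > 0\<close> by simp
    qed
  qed
  show ?thesis
    unfolding tendsto_iff dist_norm
  proof safe
    fix e :: real assume "e > 0"
    define d where "d = e / (2 * (C + 1))"
    have "d > 0" using C \<open>e > 0\<close> by (simp add: d_def)
    obtain p n where p: "\<And>z. norm z = 1 \<Longrightarrow> norm (P z - poly p z / z ^ n) < d"
      using laurent_poly_dense[OF P \<open>d > 0\<close>] by blast
    define q where "q z = poly p z / z ^ n" for z
    have q: "continuous_on (sphere 0 1) q"
      unfolding q_def by (intro continuous_intros) auto
    have "(\<lambda>j. circle_mean (\<lambda>z. u j z * q z)) \<longlonglongrightarrow> 0"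
    proof -
      have "circle_mean (\<lambda>z. u j z * q z) =
          (\<Sum>i\<le>degree p. coeff p i * circle_mean (\<lambda>z. u j z * (if n \<le> i then z ^ (i - n) else 1 / z ^ (n - i))))" for j
        unfolding q_def using circle_mean_laurent[OF us continuous_on_id, of j p n] by simp
      moreover have "(\<lambda>j. circle_mean (\<lambda>z. u j z * (if n \<le> i then z ^ (i - n) else 1 / z ^ (n - i)))) \<longlonglongrightarrow> 0" for i
        using pos[of "i - n"] neg[of "n - i"] by (cases "n \<le> i") auto
      ultimately show ?thesis
        by (simp only:) (intro tendsto_null_sum tendsto_mult_right_zero)
    qed
    then have "\<forall>\<^sub>F j in sequentially. norm (circle_mean (\<lambda>z. u j z * q z)) < e / 2"
      using tendstoD[of "\<lambda>j. circle_mean (\<lambda>z. u j z * q z)" 0 sequentially "e / 2"] \<open>e > 0\<close>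
      by (simp add: dist_norm)
    then show "\<forall>\<^sub>F j in sequentially. norm (circle_mean (\<lambda>z. u j z * P z) - 0) < e"
    proof eventually_elim
      case (elim j)
      have "circle_mean (\<lambda>z. u j z * P z) = circle_mean (\<lambda>z. u j z * q z) + circle_mean (\<lambda>z. u j z * (P z - q z))"
        by (simp add: right_diff_distrib circle_mean_diff continuous_on_mult us P q)
      moreover have "norm (circle_mean (\<lambda>z. u j z * (P z - q z))) \<le> C * d"
      proof (rule norm_circle_mean_bound)
        show "continuous_on (sphere 0 1) (\<lambda>z. u j z * (P z - q z))"
          by (intro continuous_on_mult continuous_on_diff us P q)
        fix z :: complex assume z: "norm z = 1"
        show "norm (u j z * (P z - q z)) \<le> C * d"
          unfolding norm_mult q_def using p[OF z] bound[of z j] z C by (intro mult_mono) simp_all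
      qed
      moreover have "C * d \<le> e / 2" using C \<open>e > 0\<close> by (simp add: d_def field_simps)
      ultimately show ?case
        using elim norm_triangle_ineq[of "circle_mean (\<lambda>z. u j z * q z)" "circle_mean (\<lambda>z. u j z * (P z - q z))"] by simp
    qed
  qed
qed

section \<open>Means of compositions\<close>

lemma circle_mean_power: "circle_mean (\<lambda>z. z ^ k) = 0 ^ k"
  by (intro circle_mean_holomorphic[of "\<lambda>z. z ^ k"] continuous_intros holomorphic_intros)

text \<open>The properties of a finite Blaschke product vanishing at 0 on which the integral
  identities rest. Rotations are included, so |lam| < 1 has to be assumed where it matters.\<close>

locale circle_map =
  fixes B :: "complex \<Rightarrow> complex"
  assumes cont: "continuous_on (cball 0 1) B" and hol: "B holomorphic_on ball 0 1"
    and unimodular: "norm z = 1 \<Longrightarrow> norm (B z) = 1" and B_0 [simp]: "B 0 = 0"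
begin

lemma cont_circle: "continuous_on (sphere 0 1) B"
  using cont by (rule continuous_on_subset) auto

lemma compose_cont:
  assumes "continuous_on (sphere 0 1) h"
  shows "continuous_on (sphere 0 1) (\<lambda>z. h (B z))"
  using unimodular by (intro continuous_on_compose2[OF assms cont_circle]) auto

text \<open>Continuity up to the circle is glued from two relatively open pieces of the closed disc:
  the open disc, where the quotient is holomorphic, and the punctured closed disc, where it is
  \<open>B z / z\<close>.\<close>

lemma quotient:
  obtains g where "continuous_on (cball 0 1) g" "g holomorphic_on ball 0 1" "\<And>z. z \<in> cball 0 1 \<Longrightarrow> B z = z * g z"
proof -
  obtain h where h: "h holomorphic_on ball 0 1" "\<And>z. norm z < 1 \<Longrightarrow> B z = z * h z"
    using Schwarz3[OF hol B_0] by metis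
  define g where "g z = (if z = 0 then h 0 else B z / z)" for z
  have g_eq: "g z = h z" if "z \<in> ball 0 1" for z using h(2)[of z] that by (simp add: g_def)
  have g_hol: "g holomorphic_on ball 0 1"
    using h(1) by (rule holomorphic_transform) (simp add: g_eq)
  have split: "cball 0 1 = ball 0 1 \<union> (cball 0 1 - {0 :: complex})" by auto
  have c: "continuous_on (cball 0 1 - {0}) g"
  proof -
    have "continuous_on (cball 0 1 - {0}) (\<lambda>z. B z / z)"
      using cont by (intro continuous_on_divide continuous_on_id) (auto intro: continuous_on_subset)
    then show ?thesis by (rule continuous_on_eq) (simp add: g_def)
  qed
  have o1: "openin (top_of_set (cball 0 1)) (ball (0::complex) 1)"
    by (rule open_subset) auto
  have "openin (top_of_set (cball 0 1)) (cball 0 1 \<inter> - {0::complex})"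
    by (rule openin_open_Int) auto
  then have o2: "openin (top_of_set (cball 0 1)) (cball 0 1 - {0::complex})"
    by (simp add: Diff_eq)
  have "continuous_on (cball 0 1) g"
    using o1 o2 c holomorphic_on_imp_continuous_on[OF g_hol]
    by (subst (asm) (1 2) split, subst split) (rule continuous_on_Un_local_open)
  moreover have "B z = z * g z" if "z \<in> cball 0 1" for z
    using B_0 by (simp add: g_def del: B_0)
  ultimately show thesis using that g_hol by blast
qed

text \<open>
  By \<^const>\<open>circle_mean\<close> these are the Taylor coefficients of $B$ of orders 1 and 2.
\<close>

definition lam :: complex where "lam = circle_mean (\<lambda>z. B z / z)"
definition tau :: complex where "tau = circle_mean (\<lambda>z. B z / z\<^sup>2)"

lemma lam_quotient:
  assumes "continuous_on (cball 0 1) g" "g holomorphic_on ball 0 1" "\<And>z. z \<in> cball 0 1 \<Longrightarrow> B z = z * g z"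
  shows "lam = g 0"
proof -
  have "lam = circle_mean g"
    unfolding lam_def by (rule circle_mean_cong) (use assms(3) in auto)
  then show ?thesis using circle_mean_holomorphic[OF assms(1,2)] by simp
qed

lemma lam_deriv: "lam = deriv B 0"
  using circle_mean_divide_power[OF cont hol, of 1] by (simp add: lam_def)

text \<open>Here \<open>B z ^ k\<close> is a power of the value, not an iterate. Writing B = z g
  leaves holomorphic integrands, whose means are their values at 0; \<open>0 ^ k\<close> is 1 for k
  = 0.\<close>

lemma circle_mean_iterate_divide:
  "circle_mean (\<lambda>z. B z ^ Suc k / z) = lam * 0 ^ k"
  "circle_mean (\<lambda>z. B z ^ Suc (Suc k) / z\<^sup>2) = lam\<^sup>2 * 0 ^ k"
proof -
  obtain g where g: "continuous_on (cball 0 1) g" "g holomorphic_on ball 0 1" "\<And>z. z \<in> cball 0 1 \<Longrightarrow> B z = z * g z"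
    by (rule quotient) blast
  have lam_g: "lam = g 0" by (rule lam_quotient) (fact g)+
  have nz: "z \<noteq> 0" if "norm z = 1" for z :: complex using that by auto
  have "circle_mean (\<lambda>z. B z ^ Suc k / z) = circle_mean (\<lambda>z. g z * B z ^ k)"
  proof (rule circle_mean_cong)
    fix z :: complex assume z: "norm z = 1"
    have "B z ^ Suc k / z = B z / z * B z ^ k" by simp
    also have "B z / z = g z" using g(3)[of z] z nz[OF z] by simp
    finally show "B z ^ Suc k / z = g z * B z ^ k" .
  qed
  also have "\<dots> = g 0 * B 0 ^ k"
    by (intro circle_mean_holomorphic[of "\<lambda>z. g z * B z ^ k"] continuous_intros holomorphic_intros g cont hol)
  finally show "circle_mean (\<lambda>z. B z ^ Suc k / z) = lam * 0 ^ k" by (simp add: lam_g)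
  have "circle_mean (\<lambda>z. B z ^ Suc (Suc k) / z\<^sup>2) = circle_mean (\<lambda>z. (g z)\<^sup>2 * B z ^ k)"
  proof (rule circle_mean_cong)
    fix z :: complex assume z: "norm z = 1"
    have "B z ^ Suc (Suc k) / z\<^sup>2 = (B z / z)\<^sup>2 * B z ^ k" by (simp add: power2_eq_square)
    also have "B z / z = g z" using g(3)[of z] z nz[OF z] by simp
    finally show "B z ^ Suc (Suc k) / z\<^sup>2 = (g z)\<^sup>2 * B z ^ k" .
  qed
  also have "\<dots> = (g 0)\<^sup>2 * B 0 ^ k"
    by (intro circle_mean_holomorphic[of "\<lambda>z. (g z)\<^sup>2 * B z ^ k"] continuous_intros holomorphic_intros g cont hol)
  finally show "circle_mean (\<lambda>z. B z ^ Suc (Suc k) / z\<^sup>2) = lam\<^sup>2 * 0 ^ k" by (simp add: lam_g)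
qed

text \<open>Arc length is invariant under \<open>B\<close> because \<open>B\<close> fixes 0:
  positive moments come from the mean value property and negative ones by conjugation.\<close>

lemma circle_mean_compose:
  assumes h: "continuous_on (sphere 0 1) h"
  shows "circle_mean (\<lambda>z. h (B z)) = circle_mean h"
proof -
  have pos: "circle_mean (\<lambda>z. B z ^ k) = circle_mean (\<lambda>z. z ^ k)" for k
  proof -
    have "circle_mean (\<lambda>z. B z ^ k) = B 0 ^ k"
      by (intro circle_mean_holomorphic[of "\<lambda>z. B z ^ k"] continuous_intros holomorphic_intros cont hol)
    then show ?thesis by (simp add: circle_mean_power)
  qed
  have "circle_mean (\<lambda>z. 1 * h (B z)) = circle_mean (\<lambda>z. 1 * h z)"
  proof (rule circle_mean_compose_eqI[OF _ _ cont_circle unimodular _ _ h])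
    fix k
    show "circle_mean (\<lambda>z. 1 * B z ^ k) = circle_mean (\<lambda>z. 1 * z ^ k)" using pos by simp
    have "circle_mean (\<lambda>z. 1 * (1 / B z ^ k)) = circle_mean (\<lambda>z. cnj (B z ^ k))"
      by (rule circle_mean_cong) (simp add: cnj_eq_inverse unimodular power_one_over)
    also have "\<dots> = circle_mean (\<lambda>z. cnj (z ^ k))" unfolding circle_mean_cnj pos ..
    also have "\<dots> = circle_mean (\<lambda>z. 1 * (1 / z ^ k))"
      by (rule circle_mean_cong) (simp add: cnj_eq_inverse power_one_over)
    finally show "circle_mean (\<lambda>z. 1 * (1 / B z ^ k)) = circle_mean (\<lambda>z. 1 * (1 / z ^ k))" .
  qed (auto intro: continuous_intros)
  then show ?thesis by simp
qed

text \<open>The adjoint of composition with \<open>B\<close> multiplies z by \<open>cnj lam\<close>.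
  Against a nonnegative power of \<open>B\<close> the mean vanishes; against B^(-k) it is the
  conjugate of the coefficient of z in B^k, which can be nonzero only for k = 1.\<close>

lemma circle_mean_times_compose:
  assumes h: "continuous_on (sphere 0 1) h"
  shows "circle_mean (\<lambda>z. z * h (B z)) = cnj lam * circle_mean (\<lambda>z. z * h z)"
proof -
  have "circle_mean (\<lambda>z. z * h (B z)) = circle_mean (\<lambda>z. (cnj lam * z) * h z)"
  proof (rule circle_mean_compose_eqI[OF _ _ cont_circle unimodular _ _ h])
    fix k :: nat
    have "circle_mean (\<lambda>z. z * B z ^ k) = 0 * B 0 ^ k"
      by (intro circle_mean_holomorphic[of "\<lambda>z. z * B z ^ k"] continuous_intros holomorphic_intros cont hol)
    then show "circle_mean (\<lambda>z. z * B z ^ k) = circle_mean (\<lambda>z. (cnj lam * z) * z ^ k)"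
      using circle_mean_power[of "Suc k"] by (simp add: mult.assoc circle_mean_cmult)
    assume "k > 0"
    then obtain j where k: "k = Suc j" by (cases k) auto
    have "circle_mean (\<lambda>z. z * (1 / B z ^ k)) = circle_mean (\<lambda>z. cnj (B z ^ Suc j / z))"
      by (rule circle_mean_cong) (simp add: cnj_eq_inverse unimodular power_one_over k mult_ac)
    also have "\<dots> = cnj lam * 0 ^ j" unfolding circle_mean_cnj circle_mean_iterate_divide by simp
    also have "\<dots> = cnj lam * circle_mean (\<lambda>z. cnj (z ^ j))" unfolding circle_mean_cnj circle_mean_power by simp
    also have "\<dots> = cnj lam * circle_mean (\<lambda>z. z * (1 / z ^ k))"
      by (intro arg_cong2[of _ _ _ _ "(*)"] circle_mean_cong refl) (auto simp: cnj_eq_inverse power_one_over k)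
    finally show "circle_mean (\<lambda>z. z * (1 / B z ^ k)) = circle_mean (\<lambda>z. (cnj lam * z) * (1 / z ^ k))"
      by (simp add: mult.assoc circle_mean_cmult flip: times_divide_eq_right)
  qed (auto intro!: continuous_intros)
  then show ?thesis by (simp add: mult.assoc circle_mean_cmult)
qed

text \<open>The same computation with the coefficient of z^2 in B^k: it is \<open>tau\<close> for k
  = 1, the square of \<open>lam\<close> for k = 2 and 0 for larger k.\<close>

lemma circle_mean_square_times_compose:
  assumes h: "continuous_on (sphere 0 1) h"
  shows "circle_mean (\<lambda>z. z\<^sup>2 * h (B z)) =
    (cnj lam)\<^sup>2 * circle_mean (\<lambda>z. z\<^sup>2 * h z) + cnj tau * circle_mean (\<lambda>z. z * h z)"
proof -
  have "circle_mean (\<lambda>z. z\<^sup>2 * h (B z)) = circle_mean (\<lambda>z. ((cnj lam)\<^sup>2 * z\<^sup>2 + cnj tau * z) * h z)"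
  proof (rule circle_mean_compose_eqI[OF _ _ cont_circle unimodular _ _ h])
    fix k :: nat
    have "circle_mean (\<lambda>z. z\<^sup>2 * B z ^ k) = 0\<^sup>2 * B 0 ^ k"
      by (intro circle_mean_holomorphic[of "\<lambda>z. z\<^sup>2 * B z ^ k"] continuous_intros holomorphic_intros cont hol)
    moreover have "circle_mean (\<lambda>z. ((cnj lam)\<^sup>2 * z\<^sup>2 + cnj tau * z) * z ^ k) = ((cnj lam)\<^sup>2 * 0\<^sup>2 + cnj tau * 0) * 0 ^ k"
      by (intro circle_mean_holomorphic[of "\<lambda>z. ((cnj lam)\<^sup>2 * z\<^sup>2 + cnj tau * z) * z ^ k"] continuous_intros holomorphic_intros)
    ultimately show "circle_mean (\<lambda>z. z\<^sup>2 * B z ^ k) = circle_mean (\<lambda>z. ((cnj lam)\<^sup>2 * z\<^sup>2 + cnj tau * z) * z ^ k)" by simp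
    assume "k > 0"
    then obtain j where k: "k = Suc j" by (cases k) auto
    have nz: "z \<noteq> 0" if "norm z = 1" for z :: complex using that by auto
    have "circle_mean (\<lambda>z. z\<^sup>2 * (1 / B z ^ k)) = circle_mean (\<lambda>z. cnj (B z ^ Suc j / z\<^sup>2))"
      by (rule circle_mean_cong) (simp add: cnj_eq_inverse unimodular power_one_over k mult_ac)
    also have "\<dots> = cnj (circle_mean (\<lambda>z. B z ^ Suc j / z\<^sup>2))" by (rule circle_mean_cnj)
    also have "circle_mean (\<lambda>z. B z ^ Suc j / z\<^sup>2) = lam\<^sup>2 * circle_mean (\<lambda>z. z ^ Suc j / z\<^sup>2) + tau * circle_mean (\<lambda>z. z ^ j)"
    proof (cases j)
      case 0
      have "circle_mean (\<lambda>z. z ^ Suc j / z\<^sup>2) = circle_mean (\<lambda>z. cnj (z ^ 1))"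
        by (rule circle_mean_cong) (auto simp: 0 power2_eq_square cnj_eq_inverse)
      also have "\<dots> = 0" unfolding circle_mean_cnj circle_mean_power by simp
      finally show ?thesis using circle_mean_power[of 0] by (simp add: 0 tau_def)
    next
      case (Suc i)
      have "circle_mean (\<lambda>z. z ^ Suc j / z\<^sup>2) = circle_mean (\<lambda>z. z ^ i)"
        using nz by (intro circle_mean_cong) (auto simp: Suc power2_eq_square)
      then show ?thesis
        using circle_mean_iterate_divide(2)[of i] circle_mean_power[of i] circle_mean_power[of j] by (simp add: Suc)
    qed
    also have "cnj (lam\<^sup>2 * circle_mean (\<lambda>z. z ^ Suc j / z\<^sup>2) + tau * circle_mean (\<lambda>z. z ^ j)) =
        (cnj lam)\<^sup>2 * circle_mean (\<lambda>z. cnj (z ^ Suc j / z\<^sup>2)) + cnj tau * circle_mean (\<lambda>z. cnj (z ^ j))"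
      unfolding circle_mean_cnj by simp
    also have "\<dots> = circle_mean (\<lambda>z. (cnj lam)\<^sup>2 * cnj (z ^ Suc j / z\<^sup>2)) + circle_mean (\<lambda>z. cnj tau * cnj (z ^ j))"
      unfolding circle_mean_cmult ..
    also have "\<dots> = circle_mean (\<lambda>z. (cnj lam)\<^sup>2 * cnj (z ^ Suc j / z\<^sup>2) + cnj tau * cnj (z ^ j))"
      by (rule circle_mean_add[symmetric]) (auto intro!: continuous_intros)
    also have "\<dots> = circle_mean (\<lambda>z. ((cnj lam)\<^sup>2 * z\<^sup>2 + cnj tau * z) * (1 / z ^ k))"
      using nz by (intro circle_mean_cong) (simp add: k cnj_eq_inverse power_one_over field_simps)
    finally show "circle_mean (\<lambda>z. z\<^sup>2 * (1 / B z ^ k)) =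
        circle_mean (\<lambda>z. ((cnj lam)\<^sup>2 * z\<^sup>2 + cnj tau * z) * (1 / z ^ k))" .
  qed (auto intro!: continuous_intros)
  also have "\<dots> = circle_mean (\<lambda>z. (cnj lam)\<^sup>2 * (z\<^sup>2 * h z) + cnj tau * (z * h z))"
    by (rule circle_mean_cong) (simp add: algebra_simps)
  also have "\<dots> = circle_mean (\<lambda>z. (cnj lam)\<^sup>2 * (z\<^sup>2 * h z)) + circle_mean (\<lambda>z. cnj tau * (z * h z))"
    by (intro circle_mean_add continuous_intros h)
  finally show ?thesis by (simp only: circle_mean_cmult)
qed

end

section \<open>Riesz products\<close>

context circle_map begin

text \<open>
  The conditional expectation of $z$ given $B$, with respect to arc length, is $\overline\lambda B$ with
  $\lambda = B'(0)$. So the functions \<^term>\<open>dif\<close> $\circ\, B^n$ are reverse martingale differences, and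
  $B^n = \sum_{k \ge 0} \overline\lambda^k\,$\<^term>\<open>dif\<close> $\circ\, B^{n+k}$.
\<close>

definition dif :: "complex \<Rightarrow> complex" where "dif z = z - cnj lam * B z"

lemma dif_cont: "continuous_on (sphere 0 1) dif"
  unfolding dif_def[abs_def] by (intro continuous_intros cont_circle)

lemma circle_mean_dif_compose:
  assumes h: "continuous_on (sphere 0 1) h"
  shows "circle_mean (\<lambda>z. dif z * h (B z)) = 0"
proof -
  have hB: "continuous_on (sphere 0 1) (\<lambda>z. h (B z))" by (rule compose_cont[OF h])
  have "circle_mean (\<lambda>z. dif z * h (B z)) = circle_mean (\<lambda>z. z * h (B z) - cnj lam * (B z * h (B z)))"
    by (rule circle_mean_cong) (simp add: dif_def algebra_simps)
  also have "\<dots> = circle_mean (\<lambda>z. z * h (B z)) - cnj lam * circle_mean (\<lambda>z. B z * h (B z))"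
    unfolding circle_mean_cmult[symmetric] by (intro circle_mean_diff continuous_intros hB cont_circle)
  also have "circle_mean (\<lambda>z. B z * h (B z)) = circle_mean (\<lambda>z. z * h z)"
    by (rule circle_mean_compose[of "\<lambda>z. z * h z"]) (intro continuous_intros h)
  finally show ?thesis by (simp add: circle_mean_times_compose[OF h])
qed

lemma circle_mean_cnj_dif_compose:
  assumes h: "continuous_on (sphere 0 1) h"
  shows "circle_mean (\<lambda>z. cnj (dif z) * h (B z)) = 0"
  using circle_mean_dif_compose[of "\<lambda>z. cnj (h z)"] h circle_mean_cnj[of "\<lambda>z. cnj (dif z) * h (B z)"]
  by (simp add: continuous_on_cnj)

text \<open>A conditional Pythagoras theorem: z has modulus 1 and its projection cnj lam * B has
  squared modulus |lam|^2, so the conditional variance is constant.\<close>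

lemma circle_mean_dif_cnj_dif_compose:
  assumes h: "continuous_on (sphere 0 1) h"
  shows "circle_mean (\<lambda>z. dif z * cnj (dif z) * h (B z)) = (1 - cnj lam * lam) * circle_mean h"
proof -
  have hB: "continuous_on (sphere 0 1) (\<lambda>z. h (B z))" by (rule compose_cont[OF h])
  have inv: "cnj z * z = 1" "cnj (B z) * B z = 1" if "norm z = 1" for z
    using that unimodular[OF that] by (simp_all add: mult.commute flip: complex_norm_square)
  have 1: "circle_mean (\<lambda>z. z * (cnj (B z) * h (B z))) = cnj lam * circle_mean h"
  proof -
    have "circle_mean (\<lambda>z. z * (cnj (B z) * h (B z))) = cnj lam * circle_mean (\<lambda>z. z * (cnj z * h z))"
      by (rule circle_mean_times_compose[of "\<lambda>z. cnj z * h z"]) (intro continuous_intros h)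
    also have "circle_mean (\<lambda>z. z * (cnj z * h z)) = circle_mean h"
      using inv by (intro circle_mean_cong) (metis mult.assoc mult.commute mult_1)
    finally show ?thesis .
  qed
  have 2: "circle_mean (\<lambda>z. cnj z * (B z * h (B z))) = lam * circle_mean h"
  proof -
    have "circle_mean (\<lambda>z. z * cnj (B z * h (B z))) = cnj lam * circle_mean (\<lambda>z. z * cnj (z * h z))"
      by (rule circle_mean_times_compose[of "\<lambda>z. cnj (z * h z)"]) (intro continuous_intros h)
    also have "circle_mean (\<lambda>z. z * cnj (z * h z)) = circle_mean (\<lambda>z. cnj (h z))"
      using inv by (intro circle_mean_cong) (simp, metis mult.assoc mult.commute mult_1)
    finally have "cnj (circle_mean (\<lambda>z. z * cnj (B z * h (B z)))) = lam * circle_mean h"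
      by (simp add: circle_mean_cnj)
    then show ?thesis unfolding circle_mean_cnj[symmetric] by simp
  qed
  have "circle_mean (\<lambda>z. dif z * cnj (dif z) * h (B z)) =
      circle_mean (\<lambda>z. (1 + cnj lam * lam) * h (B z) - (lam * (z * (cnj (B z) * h (B z))) + cnj lam * (cnj z * (B z * h (B z)))))"
  proof (rule circle_mean_cong)
    fix z :: complex assume z: "norm z = 1"
    have "dif z * cnj (dif z) * h (B z) = (cnj z * z + cnj lam * lam * (cnj (B z) * B z)) * h (B z)
        - (lam * (z * (cnj (B z) * h (B z))) + cnj lam * (cnj z * (B z * h (B z))))"
      by (simp add: dif_def algebra_simps)
    then show "dif z * cnj (dif z) * h (B z) = (1 + cnj lam * lam) * h (B z)
        - (lam * (z * (cnj (B z) * h (B z))) + cnj lam * (cnj z * (B z * h (B z))))"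
      by (simp add: inv[OF z])
  qed
  also have "\<dots> = (1 + cnj lam * lam) * circle_mean (\<lambda>z. h (B z)) -
      (lam * circle_mean (\<lambda>z. z * (cnj (B z) * h (B z))) + cnj lam * circle_mean (\<lambda>z. cnj z * (B z * h (B z))))"
    by (subst circle_mean_diff circle_mean_add circle_mean_cmult; (intro continuous_intros hB cont_circle)?)+ simp
  also have "\<dots> = (1 - cnj lam * lam) * circle_mean h"
    unfolding 1 2 circle_mean_compose[OF h] by (simp add: algebra_simps)
  finally show ?thesis .
qed

text \<open>In the expansion of the square all terms with (cnj lam)^2 cancel, and only the second
  Taylor coefficient survives. This is the origin of the cross terms.\<close>

lemma circle_mean_dif_square_compose:
  assumes h: "continuous_on (sphere 0 1) h"
  shows "circle_mean (\<lambda>z. (dif z)\<^sup>2 * h (B z)) = cnj tau * circle_mean (\<lambda>z. z * h z)"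
proof -
  have hB: "continuous_on (sphere 0 1) (\<lambda>z. h (B z))" by (rule compose_cont[OF h])
  have "circle_mean (\<lambda>z. (dif z)\<^sup>2 * h (B z)) =
      circle_mean (\<lambda>z. z\<^sup>2 * h (B z) - (2 * cnj lam * (z * (B z * h (B z))) - (cnj lam)\<^sup>2 * ((B z)\<^sup>2 * h (B z))))"
    by (rule circle_mean_cong) (simp add: dif_def power2_eq_square algebra_simps)
  also have "\<dots> = circle_mean (\<lambda>z. z\<^sup>2 * h (B z)) - (2 * cnj lam * circle_mean (\<lambda>z. z * (B z * h (B z)))
      - (cnj lam)\<^sup>2 * circle_mean (\<lambda>z. (B z)\<^sup>2 * h (B z)))"
    by (subst circle_mean_diff circle_mean_cmult; (intro continuous_intros hB cont_circle)?)+ simp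
  also have "circle_mean (\<lambda>z. z * (B z * h (B z))) = cnj lam * circle_mean (\<lambda>z. z * (z * h z))"
    by (rule circle_mean_times_compose[of "\<lambda>z. z * h z"]) (intro continuous_intros h)
  also have "circle_mean (\<lambda>z. (B z)\<^sup>2 * h (B z)) = circle_mean (\<lambda>z. z\<^sup>2 * h z)"
    by (rule circle_mean_compose[of "\<lambda>z. z\<^sup>2 * h z"]) (intro continuous_intros h)
  also have "circle_mean (\<lambda>z. z * (z * h z)) = circle_mean (\<lambda>z. z\<^sup>2 * h z)"
    by (simp add: power2_eq_square mult.assoc)
  finally show ?thesis
    unfolding circle_mean_square_times_compose[OF h] by (simp add: power2_eq_square algebra_simps)
qed

text \<open>One factor of a Riesz product. Halving makes it nonnegative for |c| <= 1, as |dif| <= 2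
  on the circle; with the 1/2 from taking the real part this yields the coefficients c/4
  below.\<close>

definition weight :: "complex \<Rightarrow> complex \<Rightarrow> real" where "weight c z = 1 + Re (c * dif z) / 2"

lemma weight_eq: "of_real (weight c z) = 1 + c / 4 * dif z + cnj c / 4 * cnj (dif z)"
  by (simp add: weight_def complex_eq_iff field_simps)

lemma weight_cont: "continuous_on (sphere 0 1) (weight c)"
  unfolding weight_def[abs_def] by (intro continuous_intros dif_cont) auto

text \<open>The weight has conditional mean 1 given \<open>B\<close>, since \<open>dif\<close> and
  its conjugate have conditional mean 0. A leading factor can thus be integrated out.\<close>

lemma circle_mean_weight_compose:
  assumes h: "continuous_on (sphere 0 1) h"
  shows "circle_mean (\<lambda>z. of_real (weight c z) * h (B z)) = circle_mean h"
proof -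
  have hB: "continuous_on (sphere 0 1) (\<lambda>z. h (B z))" by (rule compose_cont[OF h])
  have "circle_mean (\<lambda>z. of_real (weight c z) * h (B z)) =
      circle_mean (\<lambda>z. h (B z) + (c / 4 * (dif z * h (B z)) + cnj c / 4 * (cnj (dif z) * h (B z))))"
    by (rule circle_mean_cong) (simp add: weight_eq algebra_simps)
  also have "\<dots> = circle_mean (\<lambda>z. h (B z)) + (c / 4 * circle_mean (\<lambda>z. dif z * h (B z)) + cnj c / 4 * circle_mean (\<lambda>z. cnj (dif z) * h (B z)))"
    by (subst circle_mean_add circle_mean_cmult; (intro continuous_intros hB dif_cont)?)+ simp
  finally show ?thesis
    by (simp add: circle_mean_compose[OF h] circle_mean_dif_compose[OF h] circle_mean_cnj_dif_compose[OF h])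
qed

lemma circle_mean_dif_weight_compose:
  assumes h: "continuous_on (sphere 0 1) h"
  shows "circle_mean (\<lambda>z. dif z * (of_real (weight c z) * h (B z))) =
    (c * cnj tau * circle_mean (\<lambda>z. z * h z) + cnj c * (1 - cnj lam * lam) * circle_mean h) / 4"
proof -
  have hB: "continuous_on (sphere 0 1) (\<lambda>z. h (B z))" by (rule compose_cont[OF h])
  have "circle_mean (\<lambda>z. dif z * (of_real (weight c z) * h (B z))) =
      circle_mean (\<lambda>z. dif z * h (B z) + (c / 4 * ((dif z)\<^sup>2 * h (B z)) + cnj c / 4 * (dif z * cnj (dif z) * h (B z))))"
    by (rule circle_mean_cong) (simp add: weight_eq algebra_simps power2_eq_square)
  also have "\<dots> = circle_mean (\<lambda>z. dif z * h (B z)) + (c / 4 * circle_mean (\<lambda>z. (dif z)\<^sup>2 * h (B z)) + cnj c / 4 * circle_mean (\<lambda>z. dif z * cnj (dif z) * h (B z)))"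
    by (subst circle_mean_add circle_mean_cmult; (intro continuous_intros hB dif_cont)?)+ simp
  finally show ?thesis
    unfolding circle_mean_dif_compose[OF h] circle_mean_dif_square_compose[OF h] circle_mean_dif_cnj_dif_compose[OF h]
    by (simp add: add_divide_distrib mult.assoc)
qed

text \<open>The product of \<open>weight (c n)\<close> at the n-th iterate over n < k. Peeling from
  the front, with \<open>c\<close> shifted and z replaced by B(z), fits the identities for
  compositions with \<open>B\<close>.\<close>

primrec riesz :: "(nat \<Rightarrow> complex) \<Rightarrow> nat \<Rightarrow> complex \<Rightarrow> real" where
  "riesz c 0 z = 1"
| "riesz c (Suc k) z = weight (c 0) z * riesz (\<lambda>n. c (Suc n)) k (B z)"

lemma riesz_cont: "continuous_on (sphere 0 1) (riesz c k)"
proof (induction k arbitrary: c)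
  case (Suc k)
  have "continuous_on (sphere 0 1) (\<lambda>z. riesz (\<lambda>n. c (Suc n)) k (B z))"
    using unimodular by (intro continuous_on_compose2[OF Suc cont_circle]) auto
  then have "continuous_on (sphere 0 1) (\<lambda>z. weight (c 0) z * riesz (\<lambda>n. c (Suc n)) k (B z))"
    by (intro continuous_on_mult weight_cont)
  then show ?case by simp
qed simp

lemma riesz_cont': "continuous_on (sphere 0 1) (\<lambda>z. complex_of_real (riesz c k z))"
  by (intro continuous_intros riesz_cont)

text \<open>The factors are integrated out from the front, and each step shortens the iterate by
  one. Thus everything depending only on the k-th iterate is seen through its plain mean.\<close>

lemma circle_mean_riesz_compose:
  assumes "continuous_on (sphere 0 1) h"
  shows "circle_mean (\<lambda>z. of_real (riesz c k z) * h ((B ^^ k) z)) = circle_mean h"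
proof (induction k arbitrary: c)
  case (Suc k)
  have iter_cont: "continuous_on (sphere 0 1) (\<lambda>z. h ((B ^^ k) z))" for k
  proof (induction k)
    case (Suc k)
    then show ?case using compose_cont[OF Suc] by (simp add: funpow_swap1)
  qed (simp add: assms)
  have "circle_mean (\<lambda>z. of_real (riesz c (Suc k) z) * h ((B ^^ Suc k) z)) =
      circle_mean (\<lambda>z. of_real (weight (c 0) z) * (of_real (riesz (\<lambda>n. c (Suc n)) k (B z)) * h ((B ^^ k) (B z))))"
    by (simp add: mult.assoc funpow_swap1)
  also have "\<dots> = circle_mean (\<lambda>z. of_real (riesz (\<lambda>n. c (Suc n)) k z) * h ((B ^^ k) z))"
    by (rule circle_mean_weight_compose[of "\<lambda>z. of_real (riesz (\<lambda>n. c (Suc n)) k z) * h ((B ^^ k) z)"])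
       (intro continuous_on_mult riesz_cont' iter_cont)
  finally show ?case using Suc by simp
qed simp

lemma circle_mean_riesz: "circle_mean (\<lambda>z. of_real (riesz c k z)) = 1"
  using circle_mean_riesz_compose[of "\<lambda>_. 1"] by (simp add: circle_mean_const)

lemma norm_lam_le: "norm lam \<le> 1"
  unfolding lam_def
  by (rule norm_circle_mean_bound) (auto intro!: continuous_intros cont_circle simp: norm_divide unimodular)

lemma weight_nonneg:
  assumes "norm c \<le> 1" "norm z = 1"
  shows "0 \<le> weight c z"
proof -
  have "norm (dif z) \<le> norm z + norm (cnj lam * B z)"
    unfolding dif_def by (rule norm_triangle_ineq4)
  also have "\<dots> \<le> 2" using assms norm_lam_le by (simp add: norm_mult unimodular)
  finally have "norm (c * dif z) \<le> 1 * 2"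
    unfolding norm_mult using assms by (intro mult_mono) auto
  then show ?thesis using abs_Re_le_cmod[of "c * dif z"] unfolding weight_def by linarith
qed

lemma riesz_nonneg: "(\<And>n. norm (c n) \<le> 1) \<Longrightarrow> norm z = 1 \<Longrightarrow> 0 \<le> riesz c k z"
  by (induction k arbitrary: c z) (auto intro!: mult_nonneg_nonneg weight_nonneg simp: unimodular)

lemma norm_circle_mean_times_riesz_le:
  assumes u: "continuous_on (sphere 0 1) u" and c: "\<And>n. norm (c n) \<le> 1"
    and le: "\<And>z. norm z = 1 \<Longrightarrow> norm (u z) \<le> M"
  shows "norm (circle_mean (\<lambda>z. u z * of_real (riesz c k z))) \<le> M"
proof -
  have "norm (u z * of_real (riesz c k z)) \<le> M * riesz c k z" if "norm z = 1" for z
    using le[OF that] riesz_nonneg[OF c that] by (auto simp: norm_mult intro!: mult_right_mono)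
  from norm_circle_mean_le[OF continuous_on_mult[OF u riesz_cont'] riesz_cont this] show ?thesis
    by (simp add: circle_mean_riesz)
qed

text \<open>Each leading zero coefficient makes the first weight equal to 1, and z is then moved
  past \<open>B\<close> at the price of a factor \<open>cnj lam\<close>.\<close>

lemma circle_mean_id_riesz_le:
  assumes "\<And>n. norm (c n) \<le> 1" "\<And>i. i < p \<Longrightarrow> c i = 0"
  shows "norm (circle_mean (\<lambda>z. z * of_real (riesz c k z))) \<le> norm lam ^ p"
  using assms
proof (induction p arbitrary: c k)
  case 0
  then show ?case using norm_circle_mean_times_riesz_le[of "\<lambda>z. z" c 1 k] by simp
next
  case (Suc p)
  show ?case
  proof (cases k)
    case 0
    then show ?thesis using circle_mean_power[of 1] by simp
  next
    case (Suc j)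
    have "circle_mean (\<lambda>z. z * of_real (riesz c k z)) = circle_mean (\<lambda>z. z * of_real (riesz (\<lambda>n. c (Suc n)) j (B z)))"
      using Suc.prems(2)[of 0] by (simp add: Suc weight_def)
    also have "\<dots> = cnj lam * circle_mean (\<lambda>z. z * of_real (riesz (\<lambda>n. c (Suc n)) j z))"
      by (rule circle_mean_times_compose[OF riesz_cont'])
    finally show ?thesis
      using Suc.IH[of "\<lambda>n. c (Suc n)" j] Suc.prems by (simp add: norm_mult mult_left_mono)
  qed
qed

primrec iter_poly :: "(nat \<Rightarrow> complex) \<Rightarrow> nat \<Rightarrow> complex \<Rightarrow> complex" where
  "iter_poly a 0 z = a 0 * z"
| "iter_poly a (Suc k) z = a 0 * z + iter_poly (\<lambda>n. a (Suc n)) k (B z)"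

lemma iter_poly_cont: "continuous_on (sphere 0 1) (iter_poly a k)"
proof (induction k arbitrary: a)
  case (Suc k)
  have "continuous_on (sphere 0 1) (\<lambda>z. a 0 * z + iter_poly (\<lambda>n. a (Suc n)) k (B z))"
    using compose_cont[OF Suc] by (intro continuous_intros)
  then show ?case by simp
qed (auto intro!: continuous_intros)

lemma iter_poly_0_cong:
  "iter_poly (a(0 := a 0 + x)) k z = x * z + iter_poly a k z"
proof (cases k)
  case (Suc j)
  have "(\<lambda>n. (a(0 := a 0 + x)) (Suc n)) = (\<lambda>n. a (Suc n))" by auto
  then show ?thesis by (simp add: Suc algebra_simps)
qed (simp add: algebra_simps)

text \<open>
  The coefficients of $\sum_n a_n B^n$ with respect to the martingale differences.
\<close>

primrec carry :: "(nat \<Rightarrow> complex) \<Rightarrow> nat \<Rightarrow> complex" where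
  "carry a 0 = a 0"
| "carry a (Suc n) = a (Suc n) + cnj lam * carry a n"

lemma carry_shift:
  "carry ((\<lambda>n. a (Suc n))(0 := a (Suc 0) + cnj lam * a 0)) n = carry a (Suc n)"
  by (induction n) auto

text \<open>The leading term splits as a 0 * z = a 0 * dif z + cnj lam * a 0 * B z. The first part
  is tested by the first weight; the second is carried into the next coefficient, and the weight is
  integrated out. The index m = k is absent because the last term meets an empty product and z has
  mean 0.\<close>

lemma circle_mean_iter_poly_riesz:
  "circle_mean (\<lambda>z. iter_poly a k z * of_real (riesz c k z)) =
    (\<Sum>m<k. carry a m * (c m * cnj tau * circle_mean (\<lambda>z. z * of_real (riesz (\<lambda>n. c (Suc m + n)) (k - Suc m) z))
       + cnj (c m) * (1 - cnj lam * lam)) / 4)"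
proof (induction k arbitrary: a c)
  case 0
  then show ?case using circle_mean_power[of 1] by (simp add: circle_mean_cmult)
next
  case (Suc k)
  define a' where "a' = (\<lambda>n. a (Suc n))(0 := a (Suc 0) + cnj lam * a 0)"
  define c' where "c' = (\<lambda>n. c (Suc n))"
  let ?R = "\<lambda>z. complex_of_real (riesz c' k z)"
  have RB: "continuous_on (sphere 0 1) (\<lambda>z. ?R (B z))"
    by (rule compose_cont[OF riesz_cont'])
  have QB: "continuous_on (sphere 0 1) (\<lambda>z. iter_poly a' k (B z))"
    by (rule compose_cont[OF iter_poly_cont])
  have W: "continuous_on (sphere 0 1) (\<lambda>z. complex_of_real (weight (c 0) z))"
    by (intro continuous_intros weight_cont)
  have poly_eq: "iter_poly a (Suc k) z = a 0 * dif z + iter_poly a' k (B z)" for z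
    using iter_poly_0_cong[of "\<lambda>n. a (Suc n)" "cnj lam * a 0" k "B z"]
    by (simp add: a'_def dif_def algebra_simps)
  have "circle_mean (\<lambda>z. iter_poly a (Suc k) z * of_real (riesz c (Suc k) z)) =
      circle_mean (\<lambda>z. a 0 * (dif z * (of_real (weight (c 0) z) * ?R (B z))) +
        of_real (weight (c 0) z) * (iter_poly a' k (B z) * ?R (B z)))"
    unfolding poly_eq by (rule circle_mean_cong) (simp add: c'_def algebra_simps)
  also have "\<dots> = a 0 * circle_mean (\<lambda>z. dif z * (of_real (weight (c 0) z) * ?R (B z))) +
      circle_mean (\<lambda>z. of_real (weight (c 0) z) * (iter_poly a' k (B z) * ?R (B z)))"
    unfolding circle_mean_cmult[symmetric] by (intro circle_mean_add continuous_on_mult continuous_on_const dif_cont W RB QB)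
  also have "circle_mean (\<lambda>z. of_real (weight (c 0) z) * (iter_poly a' k (B z) * ?R (B z))) =
      circle_mean (\<lambda>z. iter_poly a' k z * ?R z)"
    by (rule circle_mean_weight_compose[of "\<lambda>z. iter_poly a' k z * ?R z"])
       (intro continuous_on_mult iter_poly_cont riesz_cont')
  also have "circle_mean (\<lambda>z. dif z * (of_real (weight (c 0) z) * ?R (B z))) =
      (c 0 * cnj tau * circle_mean (\<lambda>z. z * ?R z) + cnj (c 0) * (1 - cnj lam * lam)) / 4"
    by (simp add: circle_mean_dif_weight_compose[OF riesz_cont'] circle_mean_riesz)
  also have "circle_mean (\<lambda>z. iter_poly a' k z * ?R z) =
      (\<Sum>m<k. carry a (Suc m) * (c (Suc m) * cnj tau * circle_mean (\<lambda>z. z * of_real (riesz (\<lambda>n. c (Suc (Suc m) + n)) (k - Suc m) z))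
       + cnj (c (Suc m)) * (1 - cnj lam * lam)) / 4)"
    unfolding Suc.IH a'_def carry_shift c'_def by simp
  finally show ?case
    unfolding sum.lessThan_Suc_shift by (simp add: c'_def)
qed

text \<open>
  Selecting only the indices in one residue class modulo \<^term>\<open>q\<close> makes the cross terms with \<^term>\<open>tau\<close>,
  which come from the mean of the square of \<^term>\<open>dif\<close>, small.
\<close>

lemma sum_carry_le:
  assumes lam: "norm lam < 1" and q: "q > 0" "norm tau * norm lam ^ (q - 1) \<le> (1 - (norm lam)\<^sup>2) / 2"
    and M: "\<And>c. (\<And>n. norm (c n) \<le> 1) \<Longrightarrow> norm (circle_mean (\<lambda>z. iter_poly a k z * of_real (riesz c k z))) \<le> M"
  shows "(\<Sum>m<k. norm (carry a m)) \<le> q * (8 * M / (1 - (norm lam)\<^sup>2))"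
proof -
  define \<delta> where "\<delta> = 1 - (norm lam)\<^sup>2"
  have \<delta>: "\<delta> > 0" using lam by (simp add: \<delta>_def abs_square_less_1)
  have \<delta>_eq: "1 - cnj lam * lam = of_real \<delta>"
    unfolding \<delta>_def of_real_diff of_real_1 complex_norm_square by (simp add: mult.commute)
  have part: "(\<Sum>m<k. if m mod q = r then norm (carry a m) else 0) \<le> 8 * M / \<delta>" for r
  proof -
    \<comment> \<open>The signs turn \<open>carry a m * cnj (c m)\<close> into a modulus for the
      selected indices.\<close>
    define c where "c m = (if m mod q = r then sgn (carry a m) else 0)" for m
    define X where "X m = circle_mean (\<lambda>z. z * of_real (riesz (\<lambda>n. c (Suc m + n)) (k - Suc m) z))" for m
    have c: "norm (c n) \<le> 1" for n by (simp add: c_def norm_sgn)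
    \<comment> \<open>The cross term uses up at most half of the gain \<delta>, and the factor 1/4
      from the weights turns the remaining half into \<delta> / 8.\<close>
    have term_le: "(if m mod q = r then norm (carry a m) else 0) * \<delta> / 8 \<le>
        Re (carry a m * (c m * cnj tau * X m + cnj (c m) * of_real \<delta>) / 4)" for m
    proof (cases "m mod q = r")
      case True
      \<comment> \<open>The next index in the class of m is m + q, so the shifted sequence starts
        with q - 1 zeros.\<close>
      have "c (Suc m + i) = 0" if "i < q - 1" for i
      proof -
        have "(Suc m + i) mod q \<noteq> r"
        proof
          assume "(Suc m + i) mod q = r"
          then have "(m + Suc i) mod q = m mod q" using True by simp
          then have "q dvd Suc i" by (simp add: mod_eq_dvd_iff_nat)
          then show False using that by (auto dest: dvd_imp_le)
        qed
        then show ?thesis by (simp add: c_def)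
      qed
      then have "norm (X m) \<le> norm lam ^ (q - 1)"
        unfolding X_def by (intro circle_mean_id_riesz_le c) auto
      then have "norm tau * norm (X m) \<le> \<delta> / 2"
        using q(2) mult_left_mono[of "norm (X m)" "norm lam ^ (q - 1)" "norm tau"] by (simp add: \<delta>_def)
      then have "norm (carry a m) * (norm (c m) * (norm tau * norm (X m))) \<le> norm (carry a m) * (1 * (\<delta> / 2))"
        using c[of m] \<delta> by (intro mult_left_mono mult_mono) auto
      define A where "A = carry a m * (c m * cnj tau * X m)"
      have "norm A \<le> norm (carry a m) * (\<delta> / 2)"
        using \<open>norm (carry a m) * (norm (c m) * (norm tau * norm (X m))) \<le> _\<close>
        by (simp add: A_def norm_mult mult.assoc)
      moreover have eq: "carry a m * (cnj (c m) * of_real \<delta>) = of_real (norm (carry a m) * \<delta>)"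
      proof -
        have "carry a m * cnj (c m) = of_real (norm (carry a m))"
          using True complex_norm_square[of "carry a m"]
          by (cases "carry a m = 0") (auto simp: c_def sgn_eq field_simps power2_eq_square)
        then show ?thesis by (simp flip: mult.assoc)
      qed
      ultimately show ?thesis
        using True abs_Re_le_cmod[of A] unfolding distrib_left A_def[symmetric] eq by (simp add: mult.commute)
    qed (simp add: c_def)
    have "(\<Sum>m<k. if m mod q = r then norm (carry a m) else 0) * \<delta> / 8 =
        (\<Sum>m<k. (if m mod q = r then norm (carry a m) else 0) * \<delta> / 8)"
      by (simp add: sum_distrib_right sum_divide_distrib)
    also have "\<dots> \<le> (\<Sum>m<k. Re (carry a m * (c m * cnj tau * X m + cnj (c m) * of_real \<delta>) / 4))"
      by (intro sum_mono term_le)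
    also have "\<dots> = Re (circle_mean (\<lambda>z. iter_poly a k z * of_real (riesz c k z)))"
      unfolding circle_mean_iter_poly_riesz X_def \<delta>_eq Re_sum ..
    also have "\<dots> \<le> M" using complex_Re_le_cmod M[OF c] by (rule order_trans)
    finally show ?thesis using \<delta> by (simp add: field_simps)
  qed
  have "(\<Sum>m<k. norm (carry a m)) = (\<Sum>m<k. \<Sum>r<q. if m mod q = r then norm (carry a m) else 0)"
    using q(1) by (intro sum.cong refl) (simp add: sum.delta)
  also have "\<dots> = (\<Sum>r<q. \<Sum>m<k. if m mod q = r then norm (carry a m) else 0)"
    by (rule sum.swap)
  also have "\<dots> \<le> (\<Sum>r<q. 8 * M / \<delta>)" by (intro sum_mono part)
  finally show ?thesis by (simp add: \<delta>_def)
qed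

lemma summable_if_riesz_bounded:
  assumes lam: "norm lam < 1"
    and M: "\<And>c k. (\<And>n. norm (c n) \<le> 1) \<Longrightarrow> norm (circle_mean (\<lambda>z. iter_poly a k z * of_real (riesz c k z))) \<le> M"
  shows "summable (\<lambda>n. norm (a n))"
proof -
  define \<delta> where "\<delta> = 1 - (norm lam)\<^sup>2"
  have \<delta>: "\<delta> > 0" using lam by (simp add: \<delta>_def abs_square_less_1)
  \<comment> \<open>As |lam| < 1, a large enough gap pushes the cross terms below half of the gain;
    the modulus \<open>Suc p\<close> does not depend on \<open>k\<close>.\<close>
  have "(\<lambda>p. norm tau * norm lam ^ p) \<longlonglongrightarrow> norm tau * 0"
    using lam by (intro tendsto_mult_left LIMSEQ_power_zero) simp
  then have "\<forall>\<^sub>F p in sequentially. norm tau * norm lam ^ p < \<delta> / 2"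
    using \<delta> by (intro order_tendstoD(2)) auto
  then obtain p where p: "norm tau * norm lam ^ p < \<delta> / 2"
    using eventually_happens'[OF sequentially_bot] by blast
  have "(\<Sum>m<k. norm (carry a m)) \<le> Suc p * (8 * M / (1 - (norm lam)\<^sup>2))" for k
    using p M by (intro sum_carry_le[OF lam]) (auto simp: \<delta>_def less_imp_le)
  from this[of "Suc _"] have carry: "summable (\<lambda>n. norm (carry a n))"
    unfolding lessThan_Suc_atMost by (intro bounded_imp_summable[of "\<lambda>n. norm (carry a n)"]) auto
  \<comment> \<open>The recursion for \<open>carry\<close> is solved for \<open>a\<close>, so
    summability passes back to the original coefficients.\<close>
  have "summable (\<lambda>n. norm (a (Suc n)))"
  proof (rule summable_comparison_test')
    show "summable (\<lambda>n. norm (carry a (Suc n)) + norm (carry a n))"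
      using carry by (intro summable_add) (simp_all add: summable_Suc_iff[of "\<lambda>n. norm (carry a n)"] del: carry.simps)
    show "norm (norm (a (Suc n))) \<le> norm (carry a (Suc n)) + norm (carry a n)" for n
    proof -
      have "a (Suc n) = carry a (Suc n) - cnj lam * carry a n" by simp
      then have "norm (a (Suc n)) \<le> norm (carry a (Suc n)) + norm (cnj lam * carry a n)"
        by (metis norm_triangle_ineq4)
      also have "norm (cnj lam * carry a n) \<le> norm (carry a n)"
        using lam by (simp add: norm_mult mult_left_le_one_le)
      finally show ?thesis by simp
    qed
  qed
  then show ?thesis by (simp add: summable_Suc_iff[of "\<lambda>n. norm (a n)"])
qed

end

section \<open>Absolute summability of the coefficients\<close>

lemma dilation_uniform:
  assumes H: "H holomorphic_on ball 0 1" and "e > 0"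
  shows "\<forall>\<^sub>F j in sequentially. \<forall>z\<in>cball 0 (1/2). norm (H (of_real (1 - 1 / (real j + 2)) * z) - H z) \<le> e"
proof -
  have "cball 0 (1/2) \<subseteq> ball (0::complex) 1" by auto
  then have "uniformly_continuous_on (cball 0 (1/2)) H"
    using H by (intro compact_uniformly_continuous compact_cball)
      (meson continuous_on_subset holomorphic_on_imp_continuous_on)
  then obtain d where d: "d > 0" "\<And>x y. x \<in> cball 0 (1/2) \<Longrightarrow> y \<in> cball 0 (1/2) \<Longrightarrow> dist y x < d \<Longrightarrow> dist (H y) (H x) < e"
    using \<open>e > 0\<close> unfolding uniformly_continuous_on_def by metis
  have "(\<lambda>j. 1 / (real j + 2)) \<longlonglongrightarrow> 0" by real_asymp
  then have "\<forall>\<^sub>F j in sequentially. 1 / (real j + 2) < d"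
    using d(1) by (rule order_tendstoD)
  then show ?thesis
  proof eventually_elim
    case (elim j)
    define r where "r = 1 - 1 / (real j + 2)"
    have r: "0 \<le> r" "r \<le> 1" "1 - r < d" using elim by (auto simp: r_def field_simps)
    show ?case
      unfolding r_def[symmetric]
    proof
      fix z :: complex assume z: "z \<in> cball 0 (1/2)"
      have "norm (of_real r * z) \<le> norm z"
        using r by (simp add: norm_mult mult_left_le_one_le)
      moreover have "dist (of_real r * z) z < d"
      proof -
        have "of_real r * z - z = - of_real (1 - r) * z" by (simp add: algebra_simps)
        then have "dist (of_real r * z) z = (1 - r) * norm z"
          using r unfolding dist_norm by (simp only: norm_mult norm_minus_cancel norm_of_real abs_of_nonneg)
        also have "\<dots> \<le> 1 - r" using r z by (intro mult_left_le) auto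
        finally show ?thesis using r by simp
      qed
      ultimately show "norm (H (of_real r * z) - H z) \<le> e"
        using d(2)[of z "of_real r * z"] z by (simp add: dist_norm less_imp_le)
    qed
  qed
qed

context circle_map begin

lemma norm_le_1: "norm z \<le> 1 \<Longrightarrow> norm (B z) \<le> 1"
  by (rule maximum_modulus_frontier[of B "cball 0 1"]) (auto simp: cont hol unimodular)

lemma norm_le: "z \<in> ball 0 1 \<Longrightarrow> norm (B z) \<le> norm z"
  using Schwarz_Lemma_le[OF hol B_0] norm_le_1 by simp

lemma iter_norm_le_1: "norm z \<le> 1 \<Longrightarrow> norm ((B ^^ k) z) \<le> 1"
  by (induction k) (auto intro: norm_le_1)

lemma iter_norm_le: "z \<in> ball 0 1 \<Longrightarrow> norm ((B ^^ k) z) \<le> norm z"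
proof (induction k)
  case (Suc k)
  then have "(B ^^ k) z \<in> ball 0 1" by auto
  then show ?case using norm_le[of "(B ^^ k) z"] Suc by simp
qed simp

lemma iter_continuous: "continuous_on (cball 0 1) (B ^^ k)"
proof (induction k)
  case (Suc k)
  then show ?case
    using continuous_on_compose2[OF cont Suc] iter_norm_le_1 by (auto simp: image_subset_iff)
qed (simp add: id_def)

lemma iter_holomorphic: "(B ^^ k) holomorphic_on ball 0 1"
proof (induction k)
  case (Suc k)
  have "(B ^^ k) ` ball 0 1 \<subseteq> ball 0 1" using iter_norm_le order_le_less_trans by fastforce
  then show ?case using holomorphic_on_compose_gen[OF Suc hol] by (simp add: o_def)
qed (simp add: id_def)

lemma iter_poly_eq: "iter_poly a k z = (\<Sum>n\<le>k. a n * (B ^^ n) z)"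
proof (induction k arbitrary: a z)
  case (Suc k)
  then show ?case by (simp add: sum.atMost_Suc_shift funpow_swap1 del: sum.atMost_Suc)
qed simp

text \<open>
  The tail $G \circ B^k$ has no boundary values a priori. Its dilation $G(r B^k)$ is orthogonal to the Riesz
  product, and differs from $H(rz) - {}$\<^term>\<open>iter_poly a k z\<close> by a bounded function tending to zero locally
  uniformly as $r \to 1$.
\<close>

lemma norm_circle_mean_iter_poly_riesz_le:
  assumes H: "H holomorphic_on ball 0 1" "\<And>z. z \<in> ball 0 1 \<Longrightarrow> norm (H z) \<le> M"
    and G: "G holomorphic_on ball 0 1" "\<And>z. z \<in> ball 0 1 \<Longrightarrow> norm (G z) \<le> C" "G 0 = 0"
    and eq: "\<And>z. z \<in> ball 0 1 \<Longrightarrow> H z = iter_poly a k z + G ((B ^^ k) z)"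
    and c: "\<And>n. norm (c n) \<le> 1"
  shows "norm (circle_mean (\<lambda>z. iter_poly a k z * of_real (riesz c k z))) \<le> M"
proof -
  define r where "r j = 1 - 1 / (real j + 2)" for j
  have r: "0 < r j" "r j < 1" for j by (auto simp: r_def field_simps)
  have in_ball: "of_real (r j) * z \<in> ball 0 1" if "norm z \<le> 1" for z :: complex and j
  proof -
    have "r j * norm z \<le> r j * 1" using that r[of j] by (intro mult_left_mono) auto
    then have "r j * norm z < 1" using r[of j] by linarith
    then show ?thesis using r[of j] by (simp add: norm_mult)
  qed
  have sub: "ball 0 1 \<subseteq> cball (0::complex) 1" by auto
  have dil_cont: "continuous_on (cball 0 1) (\<lambda>z. K (of_real (r j) * z))" if "K holomorphic_on ball 0 1" for K j
    using in_ball
    by (intro continuous_on_compose2[OF holomorphic_on_imp_continuous_on[OF that]] continuous_intros) auto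
  have dil_hol: "(\<lambda>z. K (of_real (r j) * z)) holomorphic_on ball 0 1" if "K holomorphic_on ball 0 1" for K j
    using holomorphic_on_compose_gen[OF _ that, of "\<lambda>z. of_real (r j) * z" "ball 0 1"] in_ball
    by (auto simp: o_def image_subset_iff intro!: holomorphic_intros)
  have Q_cont: "continuous_on (cball 0 1) (iter_poly a k)"
    unfolding iter_poly_eq[abs_def] by (intro continuous_intros iter_continuous)
  have Q_hol: "iter_poly a k holomorphic_on ball 0 1"
    unfolding iter_poly_eq[abs_def] by (intro holomorphic_intros iter_holomorphic)
  define Gd where "Gd j z = G (of_real (r j) * z)" for j z
  define u where "u j z = H (of_real (r j) * z) - iter_poly a k z - Gd j ((B ^^ k) z)" for j z
  have Gd: "continuous_on (cball 0 1) (Gd j)" "Gd j holomorphic_on ball 0 1" for j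
    unfolding Gd_def[abs_def] by (rule dil_cont[OF G(1)], rule dil_hol[OF G(1)])
  have GdB: "continuous_on (cball 0 1) (\<lambda>z. Gd j ((B ^^ k) z))" for j
    using iter_norm_le_1 by (intro continuous_on_compose2[OF Gd(1) iter_continuous]) auto
  have GdB_hol: "(\<lambda>z. Gd j ((B ^^ k) z)) holomorphic_on ball 0 1" for j
  proof -
    have "(B ^^ k) ` ball 0 1 \<subseteq> ball 0 1" using iter_norm_le order_le_less_trans by fastforce
    then show ?thesis using holomorphic_on_compose_gen[OF iter_holomorphic Gd(2)] by (simp add: o_def)
  qed
  have P: "continuous_on (sphere 0 1) (\<lambda>z. complex_of_real (riesz c k z))" by (rule riesz_cont')
  have sphere: "sphere 0 1 \<subseteq> cball (0::complex) 1" by auto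
  have u_cont: "continuous_on (cball 0 1) (u j)" for j
    unfolding u_def[abs_def] by (intro continuous_intros dil_cont H(1) Q_cont GdB)
  have "bounded (iter_poly a k ` cball 0 1)"
    by (intro compact_imp_bounded compact_continuous_image Q_cont compact_cball)
  then obtain D where "\<forall>w\<in>iter_poly a k ` cball 0 1. norm w \<le> D"
    unfolding bounded_iff by blast
  then have D: "norm (iter_poly a k z) \<le> D" if "z \<in> cball 0 1" for z using that by blast
  have lim: "(\<lambda>j. circle_mean (\<lambda>z. u j z * of_real (riesz c k z))) \<longlonglongrightarrow> 0"
  proof (rule circle_mean_tendsto_0[OF u_cont _ _ _ P])
    show "u j holomorphic_on ball 0 1" for j
      unfolding u_def[abs_def] by (intro holomorphic_intros dil_hol H(1) Q_hol GdB_hol)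
    show "norm (u j z) \<le> M + D + C" if z: "z \<in> cball 0 1" for j z
    proof -
      have "norm (u j z) \<le> norm (H (of_real (r j) * z)) + norm (iter_poly a k z) + norm (Gd j ((B ^^ k) z))"
        unfolding u_def by (meson norm_triangle_ineq4 add_right_mono order_trans)
      also have "\<dots> \<le> M + D + C"
        unfolding Gd_def using z by (intro add_mono H(2) G(2) D in_ball iter_norm_le_1) auto
      finally show ?thesis .
    qed
    show "\<forall>\<^sub>F j in sequentially. \<forall>z\<in>cball 0 (1/2). norm (u j z) \<le> e" if "e > 0" for e
    proof -
      have e2: "e / 2 > 0" using that by simp
      show ?thesis
        using dilation_uniform[OF H(1) e2] dilation_uniform[OF G(1) e2]
      proof eventually_elim
        case (elim j)
        show ?case
        proof
          fix z :: complex assume z: "z \<in> cball 0 (1/2)"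
          then have zb: "z \<in> ball 0 1" by auto
          \<comment> \<open>Iterates do not increase the modulus, so the estimate for the dilation
            of \<open>G\<close> can be used at this point too.\<close>
          have Bz: "(B ^^ k) z \<in> cball 0 (1/2)" using iter_norm_le[OF zb, of k] z by auto
          have "u j z = (H (of_real (r j) * z) - H z) - (G (of_real (r j) * (B ^^ k) z) - G ((B ^^ k) z))"
            unfolding eq[OF zb] by (simp add: u_def Gd_def)
          then have "norm (u j z) \<le> norm (H (of_real (r j) * z) - H z) + norm (G (of_real (r j) * (B ^^ k) z) - G ((B ^^ k) z))"
            by (metis norm_triangle_ineq4)
          also have "\<dots> \<le> e / 2 + e / 2"
            unfolding r_def using elim z Bz by (intro add_mono) blast+
          finally show "norm (u j z) \<le> e" by simp
        qed
      qed
    qed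
  qed
  \<comment> \<open>The dilated tail depends only on the k-th iterate, so its tested mean is its
    value at 0, which is G 0 = 0.\<close>
  have Gd_zero: "circle_mean (\<lambda>z. Gd j ((B ^^ k) z) * of_real (riesz c k z)) = 0" for j
  proof -
    have "circle_mean (\<lambda>z. of_real (riesz c k z) * Gd j ((B ^^ k) z)) = circle_mean (Gd j)"
      by (rule circle_mean_riesz_compose) (rule continuous_on_subset[OF Gd(1) sphere])
    also have "\<dots> = Gd j 0" by (rule circle_mean_holomorphic[OF Gd])
    finally show ?thesis by (simp add: Gd_def G(3) mult.commute)
  qed
  have "norm (circle_mean (\<lambda>z. iter_poly a k z * of_real (riesz c k z))) \<le>
      M + norm (circle_mean (\<lambda>z. u j z * of_real (riesz c k z)))" for j
  proof -
    have Hs: "continuous_on (sphere 0 1) (\<lambda>z. H (of_real (r j) * z))"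
      by (rule continuous_on_subset[OF dil_cont[OF H(1)] sphere])
    have us: "continuous_on (sphere 0 1) (u j)" by (rule continuous_on_subset[OF u_cont sphere])
    have Gs: "continuous_on (sphere 0 1) (\<lambda>z. Gd j ((B ^^ k) z))" by (rule continuous_on_subset[OF GdB sphere])
    have "circle_mean (\<lambda>z. iter_poly a k z * of_real (riesz c k z)) =
        circle_mean (\<lambda>z. H (of_real (r j) * z) * of_real (riesz c k z) - u j z * of_real (riesz c k z)
          - Gd j ((B ^^ k) z) * of_real (riesz c k z))"
      by (rule circle_mean_cong) (simp add: u_def algebra_simps)
    also have "\<dots> = circle_mean (\<lambda>z. H (of_real (r j) * z) * of_real (riesz c k z))
        - circle_mean (\<lambda>z. u j z * of_real (riesz c k z))"
      by (subst circle_mean_diff; (intro continuous_on_mult continuous_on_diff Hs us Gs P)?)+ (simp add: Gd_zero)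
    finally have "norm (circle_mean (\<lambda>z. iter_poly a k z * of_real (riesz c k z))) \<le>
        norm (circle_mean (\<lambda>z. H (of_real (r j) * z) * of_real (riesz c k z))) +
        norm (circle_mean (\<lambda>z. u j z * of_real (riesz c k z)))"
      by (metis norm_triangle_ineq4)
    moreover have "norm (circle_mean (\<lambda>z. H (of_real (r j) * z) * of_real (riesz c k z))) \<le> M"
      by (rule norm_circle_mean_times_riesz_le[OF Hs c]) (intro H(2) in_ball, simp)
    ultimately show ?thesis by simp
  qed
  moreover have "(\<lambda>j. M + norm (circle_mean (\<lambda>z. u j z * of_real (riesz c k z)))) \<longlonglongrightarrow> M + norm (0::complex)"
    by (intro tendsto_intros lim)
  ultimately show ?thesis
    using LIMSEQ_le_const by fastforce
qed

end

text \<open>Nothing is known of \<open>f\<close> beyond the open disc; the formula itself provides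
  the continuous extension to the circle.\<close>

lemma finite_Blaschke_product_extension:
  assumes "finite_Blaschke_product f" "f 0 = 0"
  obtains B where "circle_map B" "\<And>z. z \<in> ball 0 1 \<Longrightarrow> f z = B z"
proof -
  obtain c and N :: nat and \<alpha> where c: "norm c = 1" and "\<forall>k<N. norm (\<alpha> k) < 1"
    and f: "\<forall>z\<in>ball 0 1. f z = c * (\<Prod>k<N. (z - \<alpha> k) / (1 - cnj (\<alpha> k) * z))"
    using assms(1) unfolding finite_Blaschke_product_def by blast
  then have \<alpha>: "norm (\<alpha> k) < 1" if "k < N" for k using that by blast
  define B where "B z = c * (\<Prod>k<N. blaschke_factor (\<alpha> k) z)" for z
  have fB: "f z = B z" if "z \<in> ball 0 1" for z
    using f that by (simp add: B_def blaschke_factor_def)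
  have "circle_map B"
  proof
    show "continuous_on (cball 0 1) B"
      unfolding B_def[abs_def] using \<alpha> by (intro continuous_intros continuous_on_prod' blaschke_factor_continuous) auto
    show "B holomorphic_on ball 0 1"
      unfolding B_def[abs_def] using \<alpha> by (intro holomorphic_intros blaschke_factor_holomorphic) auto
    show "norm (B z) = 1" if "norm z = 1" for z
      using c \<alpha> that by (simp add: B_def norm_mult norm_blaschke_factor_eq_1 flip: prod_norm)
    show "B 0 = 0" using fB[of 0] assms(2) by simp
  qed
  then show thesis using that fB by blast
qed

context inner_fixing_0 begin

lemma iter_sum_limit_at_0:
  assumes "locally_uniform_limit (iter_sum b) g"
  shows "g 0 = 0"
proof -
  have "(f ^^ n) 0 = 0" for n by (induction n) auto
  then have "iter_sum b N 0 = 0" for N by (simp add: iter_sum_def)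
  then show ?thesis using locally_uniform_limit_LIMSEQ[OF assms, of 0] by (simp add: LIMSEQ_const_iff)
qed

text \<open>\<open>H\<close> is the function with H(f(z)) = g(z), so it inherits the bound
  \<open>M\<close> through the filled images, and its expansion starts with z itself. The bound
  \<open>C\<close> on the tail may depend on \<open>k\<close>; its finiteness is what the passage to
  the circle uses.\<close>

lemma iter_sum_tails:
  assumes lim: "locally_uniform_limit (iter_sum b) g" and M: "\<And>z. z \<in> ball 0 1 \<Longrightarrow> norm (g z) \<le> M"
  obtains H where "H holomorphic_on ball 0 1" "\<And>z. z \<in> ball 0 1 \<Longrightarrow> norm (H z) \<le> M"
    "\<And>k. \<exists>G C. G holomorphic_on ball 0 1 \<and> G 0 = 0 \<and> (\<forall>z\<in>ball 0 1. norm (G z) \<le> C) \<and>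
      (\<forall>z\<in>ball 0 1. H z = (\<Sum>n\<le>k. b (Suc n) * (f ^^ n) z) + G ((f ^^ k) z))"
proof -
  obtain h where h: "h holomorphic_on ball 0 1" "locally_uniform_limit (iter_sum (\<lambda>n. b (Suc n))) h"
    "\<And>z. z \<in> ball 0 1 \<Longrightarrow> g z = b 1 * f z + h (f z)"
    using iter_sum_shift[OF lim] by metis
  define H where "H z = b 1 * z + h z" for z
  have H: "H holomorphic_on ball 0 1" unfolding H_def[abs_def] by (intro holomorphic_intros h(1))
  have H_le: "norm (H w) \<le> M" if "w \<in> ball 0 1" for w
  proof (rule bound_from_image[OF H _ that])
    show "norm (H (f z)) \<le> M" if "z \<in> ball 0 1" for z
      using M[OF that] h(3)[OF that] by (simp add: H_def)
  qed
  \<comment> \<open>The induction also records that \<open>G\<close> is the sum of the shifted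
    series: this allows the next term to be split off and gives G 0 = 0 at the end.\<close>
  have "\<exists>G C. G holomorphic_on ball 0 1 \<and> locally_uniform_limit (iter_sum (\<lambda>n. b (Suc k + n))) G \<and>
      (\<forall>z\<in>ball 0 1. norm (G z) \<le> C) \<and>
      (\<forall>z\<in>ball 0 1. H z = (\<Sum>n\<le>k. b (Suc n) * (f ^^ n) z) + G ((f ^^ k) z))" for k
  proof (induction k)
    case 0
    have "norm (h z) \<le> M + norm (b 1)" if "z \<in> ball 0 1" for z
    proof -
      have "norm (h z) \<le> norm (H z) + norm (b 1 * z)"
        using norm_triangle_ineq4[of "H z" "b 1 * z"] by (simp add: H_def)
      also have "norm (b 1 * z) \<le> norm (b 1)" using that by (simp add: norm_mult mult_left_le)
      finally show ?thesis using H_le[OF that] by simp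
    qed
    then show ?case using h(1,2) by (intro exI[of _ h] exI[of _ "M + norm (b 1)"]) (auto simp: H_def)
  next
    case (Suc k)
    then obtain G C where G: "G holomorphic_on ball 0 1" "locally_uniform_limit (iter_sum (\<lambda>n. b (Suc k + n))) G"
      "\<And>z. z \<in> ball 0 1 \<Longrightarrow> norm (G z) \<le> C"
      "\<And>z. z \<in> ball 0 1 \<Longrightarrow> H z = (\<Sum>n\<le>k. b (Suc n) * (f ^^ n) z) + G ((f ^^ k) z)" by blast
    obtain G' where G': "G' holomorphic_on ball 0 1" "locally_uniform_limit (iter_sum (\<lambda>n. b (Suc k + Suc n))) G'"
      "\<And>z. z \<in> ball 0 1 \<Longrightarrow> G z = b (Suc k + 1) * f z + G' (f z)"
      using iter_sum_shift[OF G(2)] by metis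
    have "norm (G' (f z)) \<le> C + norm (b (Suc k + 1))" if "z \<in> ball 0 1" for z
    proof -
      have "norm (G' (f z)) \<le> norm (G z) + norm (b (Suc k + 1) * f z)"
        using norm_triangle_ineq4[of "G z" "b (Suc k + 1) * f z"] G'(3)[OF that] by simp
      also have "norm (b (Suc k + 1) * f z) \<le> norm (b (Suc k + 1))"
        using maps[OF that] unfolding norm_mult by (intro mult_left_le) auto
      finally show ?thesis using G(3)[OF that] by simp
    qed
    then have "norm (G' w) \<le> C + norm (b (Suc k + 1))" if "w \<in> ball 0 1" for w
      using bound_from_image[OF G'(1) _ that] by blast
    moreover have "H z = (\<Sum>n\<le>Suc k. b (Suc n) * (f ^^ n) z) + G' ((f ^^ Suc k) z)" if "z \<in> ball 0 1" for z
      using G(4)[OF that] G'(3)[OF iter_in_ball[OF that, of k]] by simp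
    ultimately show ?case using G'(1,2) by (intro exI[of _ G'] exI[of _ "C + norm (b (Suc k + 1))"]) auto
  qed
  then show thesis using that[OF H H_le] iter_sum_limit_at_0 by metis
qed

lemma summable_if_bounded:
  assumes nr: "\<not> rotation f" and fB: "finite_Blaschke_product f"
    and lim: "locally_uniform_limit (iter_sum a) g" and M: "\<And>z. z \<in> ball 0 1 \<Longrightarrow> norm (g z) \<le> M"
  shows "summable (\<lambda>n. norm (a (Suc n)))"
proof -
  obtain B where "circle_map B" and f_eq: "\<And>z. z \<in> ball 0 1 \<Longrightarrow> f z = B z"
    using finite_Blaschke_product_extension[OF fB f_0] by blast
  interpret B: circle_map B by fact
  have iter_eq: "(f ^^ n) z = (B ^^ n) z" if "z \<in> ball 0 1" for n z
  proof (induction n)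
    case (Suc n)
    then show ?case using f_eq[OF iter_in_ball[OF that, of n]] by simp
  qed simp
  have B_less: "norm (B z) < 1" if "norm z < 1" for z using maps[of z] f_eq[of z] that by simp
  \<comment> \<open>A derivative of modulus 1 at 0 is the equality case of the Schwarz lemma, in
    which \<open>f\<close> would be a rotation.\<close>
  have "norm B.lam \<noteq> 1"
  proof
    assume "norm B.lam = 1"
    then obtain \<alpha> where "\<And>z. norm z < 1 \<Longrightarrow> B z = \<alpha> * z" "norm \<alpha> = 1"
      using Schwarz_Lemma(3)[OF B.hol B.B_0 B_less, of 0] B.lam_deriv by auto
    then have "rotation f" using f_eq by (auto simp: rotation_def)
    with nr show False ..
  qed
  then have lam: "norm B.lam < 1" using B.norm_lam_le by simp
  obtain H where H: "H holomorphic_on ball 0 1" "\<And>z. z \<in> ball 0 1 \<Longrightarrow> norm (H z) \<le> M"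
    and tails: "\<And>k. \<exists>G C. G holomorphic_on ball 0 1 \<and> G 0 = 0 \<and> (\<forall>z\<in>ball 0 1. norm (G z) \<le> C) \<and>
      (\<forall>z\<in>ball 0 1. H z = (\<Sum>n\<le>k. a (Suc n) * (f ^^ n) z) + G ((f ^^ k) z))"
    by (rule iter_sum_tails[OF lim M]) blast+
  show ?thesis
  proof (rule B.summable_if_riesz_bounded[OF lam])
    fix c :: "nat \<Rightarrow> complex" and k assume c: "\<And>n. norm (c n) \<le> 1"
    obtain G C where G: "G holomorphic_on ball 0 1" "G 0 = 0" "\<forall>z\<in>ball 0 1. norm (G z) \<le> C"
      "\<forall>z\<in>ball 0 1. H z = (\<Sum>n\<le>k. a (Suc n) * (f ^^ n) z) + G ((f ^^ k) z)"
      using tails[of k] by blast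
    have H_eq: "H z = B.iter_poly (\<lambda>n. a (Suc n)) k z + G ((B ^^ k) z)" if "z \<in> ball 0 1" for z
      using G(4) that by (simp add: B.iter_poly_eq iter_eq[OF that])
    show "norm (circle_mean (\<lambda>z. B.iter_poly (\<lambda>n. a (Suc n)) k z * of_real (B.riesz c k z))) \<le> M"
      by (rule B.norm_circle_mean_iter_poly_riesz_le[OF H G(1) bspec[OF G(3)] G(2) H_eq c])
  qed
qed

text \<open>The extended iterates are bounded by 1 on the closed disc, so the Weierstrass test gives
  uniform convergence up to the circle and hence a continuous sum.\<close>

lemma series_in_disc_algebra_if_summable:
  assumes fB: "finite_Blaschke_product f" and sum: "summable (\<lambda>n. norm (a (Suc n)))"
  shows "series_in_disc_algebra (\<lambda>n z. a n * (f ^^ n) z)"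
proof -
  obtain B where "circle_map B" and f_eq: "\<And>z. z \<in> ball 0 1 \<Longrightarrow> f z = B z"
    using finite_Blaschke_product_extension[OF fB f_0] by blast
  interpret B: circle_map B by fact
  have iter_eq: "(f ^^ n) z = (B ^^ n) z" if "z \<in> ball 0 1" for n z
  proof (induction n)
    case (Suc n)
    then show ?case using f_eq[OF iter_in_ball[OF that, of n]] by simp
  qed simp
  define h where "h z = (\<Sum>i. a (Suc i) * (B ^^ Suc i) z)" for z
  have unif: "uniform_limit (cball 0 1) (\<lambda>N z. \<Sum>i<N. a (Suc i) * (B ^^ Suc i) z) h sequentially"
    unfolding h_def[abs_def]
  proof (rule Weierstrass_m_test[OF _ sum])
    fix n and z :: complex assume "z \<in> cball 0 1"
    then show "norm (a (Suc n) * (B ^^ Suc n) z) \<le> norm (a (Suc n))"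
      using B.iter_norm_le_1[of z "Suc n"] unfolding norm_mult by (intro mult_left_le) auto
  qed
  have h_cont: "continuous_on (cball 0 1) h"
    by (rule uniform_limit_theorem[OF _ unif])
       (auto intro!: always_eventually continuous_intros B.iter_continuous simp del: funpow.simps)
  have lim: "locally_uniform_limit (iter_sum a) h"
  proof (rule locally_uniform_limit_cong)
    show "locally_uniform_limit (\<lambda>N z. \<Sum>i<N. a (Suc i) * (B ^^ Suc i) z) h"
      unfolding locally_uniform_limit_def
      using uniform_limit_on_subset[OF unif] by (meson ball_subset_cball order_trans)
    show "(\<Sum>i<N. a (Suc i) * (B ^^ Suc i) z) = iter_sum a N z" if "z \<in> ball 0 1" for N z
      unfolding iter_sum_def iter_eq[OF that] by (simp only: One_nat_def sum.atLeast1_atMost_eq)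
  qed simp
  have "h holomorphic_on ball 0 1"
    using iter_sum_holomorphic lim by (rule locally_uniform_limit_holomorphic)
  then have "h \<in> disc_algebra" using h_cont by (auto simp: disc_algebra_def)
  then show ?thesis
    using lim unfolding series_in_disc_algebra_def locally_uniform_limit_def iter_sum_def[abs_def] by blast
qed

end

theorem theorem4p1:
  fixes f :: "complex \<Rightarrow> complex" and a :: "nat \<Rightarrow> complex"
  assumes "inner_function f" and "f 0 = 0" and "\<not> rotation f"
    and "\<exists>n\<ge>1. a n \<noteq> 0"
  shows "series_in_disc_algebra (\<lambda>n z. a n * (f ^^ n) z) \<longleftrightarrow>
         finite_Blaschke_product f \<and> summable (\<lambda>n. norm (a (Suc n)))"
proof -
  interpret inner_fixing_0 f using assms(1,2) by unfold_locales
  show ?thesis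
  proof
    assume "series_in_disc_algebra (\<lambda>n z. a n * (f ^^ n) z)"
    then obtain g where "g \<in> disc_algebra" and lim: "locally_uniform_limit (iter_sum a) g"
      unfolding series_in_disc_algebra_def locally_uniform_limit_def iter_sum_def[abs_def] by blast
    then obtain h where h: "continuous_on (cball 0 1) h" "\<And>z. z \<in> ball 0 1 \<Longrightarrow> h z = g z"
      by (auto simp: disc_algebra_def)
    have fB: "finite_Blaschke_product f"
      by (rule finite_Blaschke_product_if_disc_algebra[OF assms(3,4) lim h])
    obtain M where M: "\<And>z. z \<in> cball 0 1 \<Longrightarrow> norm (h z) \<le> M"
      using compact_imp_bounded[OF compact_continuous_image[OF h(1) compact_cball]] unfolding bounded_iff by blast
    have "norm (g z) \<le> M" if "z \<in> ball 0 1" for z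
      using M[of z] h(2)[OF that] that by simp
    then show "finite_Blaschke_product f \<and> summable (\<lambda>n. norm (a (Suc n)))"
      using fB summable_if_bounded[OF assms(3) fB lim] by blast
  qed (use series_in_disc_algebra_if_summable in blast)
qed

end
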